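(* Let $\mathcal C=(\mathcal C(n))_{n\ge1}$, $\mathcal C(n)\subseteq M_n(\mathbb C)^g$, be matrix balanced, closed with respect to direct sums, and suppose it contains a free $\epsilon$-neighborhood of $0$ for some $\epsilon>0$. If $X^{\mathrm b}\in M_n(\mathbb C)^g$ is in the boundary of $\mathcal C(n)$, then there is a tuple $Q\in M_n(\mathbb C)^g$ such that $\|\Lambda_Q(Y)\|\le 1$ for all $m$ and all $Y\in\mathcal C(m)$, and such that $\|\Lambda_Q(X^{\mathrm b})\|=1$. Furthermore, if $Y$ is in the interior of $\mathcal C$ (i.e., in the interior of $\mathcal C(m)$ for some $m$), then $\|\Lambda_Q(Y)\|<1$.
   Context: For $Q\in M_n(\mathbb C)^g$ and $Y\in M_m(\mathbb C)^g$, $\Lambda_Q(Y)=\sum_{j=1}^g Q_j\otimes Y_j$, with operator norm $\|\cdot\|$. $\mathcal C$ is matrix balanced if for all $m,n$, each $X\in\mathcal C(n)$ and each pair $C_1,C_2$ of $n\times m$ contractions, $C_2^*XC_1=(C_2^*X_1C_1,\dots,C_2^*X_gC_1)\in\mathcal C(m)$. It is closed with respect to direct sums if $X\in\mathcal C(n)$, $Y\in\mathcal C(m)$ imply $X\oplus Y=(X_1\oplus Y_1,\dots,X_g\oplus Y_g)\in\mathcal C(n+m)$. The free $\epsilon$-neighborhood of $0$ is $(\mathcal N_\epsilon(n))_n$ with $\mathcal N_\epsilon(n)=\{X\in M_n(\mathbb C)^g:\sum_j\|X_j\|<\epsilon\}$; $\mathcal C$ contains it if $\mathcal N_\epsilon(n)\subseteq\mathcal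 C(n)$ for all $n$. *)

theory Defs
  imports
    "HOL-Analysis.Abstract_Metric_Spaces"
    "HOL-Analysis.L2_Norm"
    "Jordan_Normal_Form.Schur_Decomposition"
begin

definition vec_norm :: "complex vec \<Rightarrow> real" where
  "vec_norm v = L2_set (\<lambda>i. cmod (v $ i)) {..<dim_vec v}"

definition op_norm :: "complex mat \<Rightarrow> real" where
  "op_norm A = Sup {vec_norm (A *\<^sub>v v) | v. v \<in> carrier_vec (dim_col A) \<and> vec_norm v \<le> 1}"

text \<open>Tuples are functions on a finite index type \<open>'g\<close>, and \<open>mat_tuples n\<close> is
  \<open>M\<^sub>n(\<complex>)\<^sup>g\<close> with \<open>g = CARD('g)\<close>. All matrix sizes below are required to be
  positive; the value of a family at size \<open>0\<close> is irrelevant.\<close>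

definition mat_tuples :: "nat \<Rightarrow> ('g::finite \<Rightarrow> complex mat) set" where
  "mat_tuples n = {X. \<forall>j. X j \<in> carrier_mat n n}"

definition tuple_norm :: "('g::finite \<Rightarrow> complex mat) \<Rightarrow> real" where
  "tuple_norm X = (\<Sum>j\<in>UNIV. op_norm (X j))"

text \<open>On \<open>mat_tuples n\<close> this is \<open>tuple_norm (\<lambda>j. X j - Y j)\<close>. The difference is written with
  an explicit size because \<open>Metric_space\<close> requires symmetry for arbitrary arguments, on which
  \<open>-\<close> takes the dimensions of its second operand.\<close>

definition tuple_dist :: "nat \<Rightarrow> ('g::finite \<Rightarrow> complex mat) \<Rightarrow> ('g \<Rightarrow> complex mat) \<Rightarrow> real" where
  "tuple_dist n X Y = tuple_norm (\<lambda>j. mat n n (\<lambda>(i, k). X j $$ (i, k) - Y j $$ (i, k)))"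

lemma tuple_dist_eq:
  assumes "X \<in> mat_tuples n" "Y \<in> mat_tuples n"
  shows "tuple_dist n X Y = tuple_norm (\<lambda>j. X j - Y j)"
proof -
  have "mat n n (\<lambda>(i, k). X j $$ (i, k) - Y j $$ (i, k)) = X j - Y j" for j
  proof -
    have "X j \<in> carrier_mat n n" "Y j \<in> carrier_mat n n" using assms by (auto simp: mat_tuples_def)
    then show ?thesis by auto
  qed
  then show ?thesis by (simp add: tuple_dist_def)
qed

lemma vec_norm_mult_mat_vec_le:
  assumes "v \<in> carrier_vec (dim_col A)" "vec_norm v \<le> 1"
  shows "vec_norm (A *\<^sub>v v) \<le> (\<Sum>i<dim_row A. \<Sum>k<dim_col A. cmod (A $$ (i, k)))"
proof -
  have v: "cmod (v $ k) \<le> 1" if "k < dim_col A" for k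
  proof -
    have "cmod (v $ k) \<le> vec_norm v"
      unfolding vec_norm_def using that assms(1)
      by (intro member_le_L2_set) auto
    then show ?thesis using assms(2) by simp
  qed
  have "vec_norm (A *\<^sub>v v) \<le> (\<Sum>i<dim_row A. cmod ((A *\<^sub>v v) $ i))"
    unfolding vec_norm_def dim_mult_mat_vec by (intro L2_set_le_sum) auto
  also have "\<dots> \<le> (\<Sum>i<dim_row A. \<Sum>k<dim_col A. cmod (A $$ (i, k)))"
  proof (intro sum_mono)
    fix i assume i: "i \<in> {..<dim_row A}"
    have "(A *\<^sub>v v) $ i = (\<Sum>k<dim_col A. A $$ (i, k) * v $ k)"
      using i assms(1) by (auto simp: scalar_prod_def lessThan_atLeast0 intro!: sum.cong)
    then have "cmod ((A *\<^sub>v v) $ i) \<le> (\<Sum>k<dim_col A. cmod (A $$ (i, k) * v $ k))"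
      by (simp add: norm_sum)
    also have "\<dots> \<le> (\<Sum>k<dim_col A. cmod (A $$ (i, k)))"
      using v by (intro sum_mono) (auto simp: norm_mult intro: mult_left_le)
    finally show "cmod ((A *\<^sub>v v) $ i) \<le> (\<Sum>k<dim_col A. cmod (A $$ (i, k)))" .
  qed
  finally show ?thesis .
qed

lemma vec_norm_mult_mat_vec_le_op_norm:
  assumes "v \<in> carrier_vec (dim_col A)" "vec_norm v \<le> 1"
  shows "vec_norm (A *\<^sub>v v) \<le> op_norm A"
  unfolding op_norm_def
proof (rule cSup_upper)
  show "bdd_above {vec_norm (A *\<^sub>v v) | v. v \<in> carrier_vec (dim_col A) \<and> vec_norm v \<le> 1}"
    by (rule bdd_aboveI[where M = "\<Sum>i<dim_row A. \<Sum>k<dim_col A. cmod (A $$ (i, k))"])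
      (use vec_norm_mult_mat_vec_le in blast)
qed (use assms in blast)

lemma op_norm_le:
  assumes "\<And>v. v \<in> carrier_vec (dim_col A) \<Longrightarrow> vec_norm v \<le> 1 \<Longrightarrow> vec_norm (A *\<^sub>v v) \<le> c"
  shows "op_norm A \<le> c"
  unfolding op_norm_def
proof (rule cSup_least)
  have "vec_norm (0\<^sub>v (dim_col A)) \<le> 1" by (simp add: vec_norm_def L2_set_def)
  then show "{vec_norm (A *\<^sub>v v) |v. v \<in> carrier_vec (dim_col A) \<and> vec_norm v \<le> 1} \<noteq> {}"
    using zero_carrier_vec by blast
qed (use assms in auto)

lemma op_norm_nonneg: "0 \<le> op_norm A"
proof -
  have "vec_norm (A *\<^sub>v 0\<^sub>v (dim_col A)) \<le> op_norm A"
    by (rule vec_norm_mult_mat_vec_le_op_norm) (auto simp: vec_norm_def L2_set_def)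
  moreover have "0 \<le> vec_norm (A *\<^sub>v 0\<^sub>v (dim_col A))" by (simp add: vec_norm_def)
  ultimately show ?thesis by simp
qed

lemma op_norm_eq_0D:
  assumes "op_norm A = 0" "i < dim_row A" "k < dim_col A"
  shows "A $$ (i, k) = 0"
proof -
  let ?e = "unit_vec (dim_col A) k"
  have "vec_norm ?e = L2_set (\<lambda>l. if l = k then 1 else 0) {..<dim_col A}"
    unfolding vec_norm_def by (intro L2_set_cong) (use assms in \<open>auto simp: unit_vec_def\<close>)
  also have "\<dots> = 1" using assms by (simp add: L2_set_def if_distrib[of "\<lambda>x. x\<^sup>2"] cong: if_cong)
  finally have e: "vec_norm ?e = 1" .
  have "cmod ((A *\<^sub>v ?e) $ i) \<le> vec_norm (A *\<^sub>v ?e)"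
    unfolding vec_norm_def using assms by (intro member_le_L2_set) auto
  also have "\<dots> \<le> op_norm A"
    by (rule vec_norm_mult_mat_vec_le_op_norm) (use e in auto)
  finally show ?thesis using assms by simp
qed

lemma op_norm_uminus: "op_norm (- A) = op_norm A"
proof -
  have "vec_norm (- A *\<^sub>v v) = vec_norm (A *\<^sub>v v)" if "v \<in> carrier_vec (dim_col A)" for v
    using that unfolding vec_norm_def by (intro L2_set_cong) (auto simp: uminus_scalar_prod)
  then have "{vec_norm (- A *\<^sub>v v) | v. v \<in> carrier_vec (dim_col A) \<and> vec_norm v \<le> 1} =
      {vec_norm (A *\<^sub>v v) | v. v \<in> carrier_vec (dim_col A) \<and> vec_norm v \<le> 1}"
    by (metis (mono_tags, opaque_lifting))
  then show ?thesis by (simp add: op_norm_def)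
qed

lemma op_norm_add_le:
  assumes "A \<in> carrier_mat n m" "B \<in> carrier_mat n m"
  shows "op_norm (A + B) \<le> op_norm A + op_norm B"
proof (rule op_norm_le)
  fix v assume v: "v \<in> carrier_vec (dim_col (A + B))" "vec_norm v \<le> 1"
  have "vec_norm ((A + B) *\<^sub>v v) = L2_set (\<lambda>i. cmod ((A *\<^sub>v v) $ i + (B *\<^sub>v v) $ i)) {..<n}"
    unfolding vec_norm_def using assms v
    by (intro L2_set_cong) (auto simp: add_mult_distrib_mat_vec)
  also have "\<dots> \<le> L2_set (\<lambda>i. cmod ((A *\<^sub>v v) $ i) + cmod ((B *\<^sub>v v) $ i)) {..<n}"
    by (intro L2_set_mono) (auto simp: norm_triangle_ineq)
  also have "\<dots> \<le> vec_norm (A *\<^sub>v v) + vec_norm (B *\<^sub>v v)"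
    unfolding vec_norm_def using assms by (auto intro: L2_set_triangle_ineq)
  also have "\<dots> \<le> op_norm A + op_norm B"
    using assms v by (intro add_mono vec_norm_mult_mat_vec_le_op_norm) auto
  finally show "vec_norm ((A + B) *\<^sub>v v) \<le> op_norm A + op_norm B" .
qed

lemma Metric_space_mat_tuples:
  "Metric_space (mat_tuples n) (tuple_dist n :: ('g::finite \<Rightarrow> complex mat) \<Rightarrow> _)"
proof
  fix X Y Z :: "'g \<Rightarrow> complex mat"
  show "0 \<le> tuple_dist n X Y"
    unfolding tuple_dist_def tuple_norm_def by (intro sum_nonneg op_norm_nonneg)
  have "mat n n (\<lambda>(i, k). X j $$ (i, k) - Y j $$ (i, k)) =
      - mat n n (\<lambda>(i, k). Y j $$ (i, k) - X j $$ (i, k))" for j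
    by auto
  then show "tuple_dist n X Y = tuple_dist n Y X"
    unfolding tuple_dist_def tuple_norm_def by (simp only: op_norm_uminus)
  {
    assume X: "X \<in> mat_tuples n" and Y: "Y \<in> mat_tuples n"
    have XY: "X j \<in> carrier_mat n n" "Y j \<in> carrier_mat n n" for j
      using X Y by (auto simp: mat_tuples_def)
    have z: "op_norm (0\<^sub>m n n) = 0"
    proof (rule antisym[OF op_norm_le op_norm_nonneg])
      fix v :: "complex Matrix.vec" assume "v \<in> carrier_vec (dim_col (0\<^sub>m n n :: complex mat))"
      then have "0\<^sub>m n n *\<^sub>v v = 0\<^sub>v n" by auto
      then show "vec_norm (0\<^sub>m n n *\<^sub>v v) \<le> 0" by (simp add: vec_norm_def L2_set_def)
    qed
    show "tuple_dist n X Y = 0 \<longleftrightarrow> X = Y"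
      unfolding tuple_dist_eq[OF X Y]
    proof
      assume "tuple_norm (\<lambda>j. X j - Y j) = 0"
      then have *: "op_norm (X j - Y j) = 0" for j
        unfolding tuple_norm_def by (simp add: sum_nonneg_eq_0_iff op_norm_nonneg)
      show "X = Y"
      proof
        fix j
        show "X j = Y j"
        proof (rule eq_matI)
          fix i k assume ik: "i < dim_row (Y j)" "k < dim_col (Y j)"
          have "(X j - Y j) $$ (i, k) = 0"
            by (rule op_norm_eq_0D[OF *]) (use ik XY[of j] in auto)
          then show "X j $$ (i, k) = Y j $$ (i, k)" using ik XY[of j] by auto
        qed (use XY[of j] in auto)
      qed
    next
      assume "X = Y"
      then have "X j - Y j = 0\<^sub>m n n" for j using XY[of j] by auto
      then show "tuple_norm (\<lambda>j. X j - Y j) = 0" by (simp add: tuple_norm_def z)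
    qed
    assume Z: "Z \<in> mat_tuples n"
    have Zj: "Z j \<in> carrier_mat n n" for j using Z by (auto simp: mat_tuples_def)
    have "op_norm (X j - Z j) \<le> op_norm (X j - Y j) + op_norm (Y j - Z j)" for j
    proof -
      have "X j - Z j = (X j - Y j) + (Y j - Z j)" using XY[of j] Zj[of j] by auto
      then show ?thesis
        using op_norm_add_le[OF minus_carrier_mat[OF XY(2)] minus_carrier_mat[OF Zj]] by metis
    qed
    then show "tuple_dist n X Z \<le> tuple_dist n X Y + tuple_dist n Y Z"
      unfolding tuple_dist_eq[OF X Y] tuple_dist_eq[OF Y Z] tuple_dist_eq[OF X Z] tuple_norm_def sum.distrib[symmetric] by (intro sum_mono)
  }
qed

definition tuple_topology :: "nat \<Rightarrow> ('g::finite \<Rightarrow> complex mat) topology" where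
  "tuple_topology n = Metric_space.mtopology (mat_tuples n) (tuple_dist n)"

definition matrix_balanced :: "(nat \<Rightarrow> ('g::finite \<Rightarrow> complex mat) set) \<Rightarrow> bool" where
  "matrix_balanced \<C> \<longleftrightarrow>
    (\<forall>m\<ge>1. \<forall>n\<ge>1. \<forall>X\<in>\<C> n. \<forall>C\<^sub>1\<in>carrier_mat n m. \<forall>C\<^sub>2\<in>carrier_mat n m.
      op_norm C\<^sub>1 \<le> 1 \<longrightarrow> op_norm C\<^sub>2 \<le> 1 \<longrightarrow> (\<lambda>j. mat_adjoint C\<^sub>2 * X j * C\<^sub>1) \<in> \<C> m)"

definition closed_direct_sums :: "(nat \<Rightarrow> ('g::finite \<Rightarrow> complex mat) set) \<Rightarrow> bool" where
  "closed_direct_sums \<C> \<longleftrightarrow>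
    (\<forall>n\<ge>1. \<forall>m\<ge>1. \<forall>X\<in>\<C> n. \<forall>Y\<in>\<C> m.
      (\<lambda>j. four_block_mat (X j) (0\<^sub>m n m) (0\<^sub>m m n) (Y j)) \<in> \<C> (n + m))"

definition free_nbhd :: "real \<Rightarrow> nat \<Rightarrow> ('g::finite \<Rightarrow> complex mat) set" where
  "free_nbhd \<epsilon> n = {X \<in> mat_tuples n. tuple_norm X < \<epsilon>}"

definition kronecker :: "complex mat \<Rightarrow> complex mat \<Rightarrow> complex mat" where
  "kronecker A B = mat (dim_row A * dim_row B) (dim_col A * dim_col B)
    (\<lambda>(i, k). A $$ (i div dim_row B, k div dim_col B) * B $$ (i mod dim_row B, k mod dim_col B))"

text \<open>The matrix type carries no zero, so \<open>\<Lambda>\<^sub>Q(Y)\<close> is summed entrywise, for \<open>Q\<close> of size \<open>n\<close>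
  and \<open>Y\<close> of size \<open>m\<close>.\<close>

definition pencil :: "nat \<Rightarrow> nat \<Rightarrow> ('g::finite \<Rightarrow> complex mat) \<Rightarrow> ('g \<Rightarrow> complex mat) \<Rightarrow> complex mat" where
  "pencil n m Q Y = mat (n * m) (n * m) (\<lambda>(i, k). \<Sum>j\<in>UNIV. kronecker (Q j) (Y j) $$ (i, k))"

end

(*
  C(n) is convex, so a real functional on M_n(C)^g is at most 1 on C(n) and at least 1 at the
  boundary point.  A second separation, as in the Effros-Winkler theorem, yields two positive
  semidefinite forms on C^n whose sum dominates twice the value of the functional on
  C2^* Y C1, simultaneously for all levels m, all Y in C(m) and all m x n matrices C1, C2:
  the set that is separated is convex because matrices can be stacked and C is closed under
  direct sums.  Factoring the forms by Gram-Schmidt turns the coefficients of the functional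
  into Q, and the domination into the norm bound for the pencil.  The forms may be degenerate;
  the functional vanishes on their null vectors, so no invertibility is needed.
*)
theory Submission
  imports Defs
begin

section \<open>Separation in coordinates\<close>

text \<open>Two forms are needed because \<open>matrix_balanced\<close> lets the left and right
  contractions vary independently. Homogeneity bounds the functional at C2^* Y C1 by r as soon as
  C1^*C1 and C2^*C2 are both at most r times the identity. The second separation replaces this
  maximum of two operator norms by an average of two quadratic forms summed over rows, and
  Gram-Schmidt turns forms into Euclidean lengths of vectors on which the pencil acts.

  The family need not be closed and the boundary point need not belong to it. All topology is
  therefore expressed by dilations: t X lies in the family for 0 < t < 1 if X is in the closure, and
  for no t > 1 if X is not interior. Homogeneity of the norm turns this into the norm being at most
  1 at the boundary and below 1 inside.

  The trace bound 2 is twice the value 1 of the second functional at the pair of identities, since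
  the forms are its coefficients plus their adjoints. The vectors that test the pencil at the
  boundary point have squared lengths with sum at most 2, so the product of their lengths is at most
  1.\<close>

definition supported_on :: "'i set \<Rightarrow> ('i \<Rightarrow> complex) set" where
  "supported_on I = {x. \<forall>i. i \<notin> I \<longrightarrow> x i = 0}"

lemma supported_on_add: "x \<in> supported_on I \<Longrightarrow> y \<in> supported_on I \<Longrightarrow> (\<lambda>i. x i + y i) \<in> supported_on I"
  and supported_on_scale: "x \<in> supported_on I \<Longrightarrow> (\<lambda>i. c * x i) \<in> supported_on I"
  and supported_on_uminus: "x \<in> supported_on I \<Longrightarrow> (\<lambda>i. - x i) \<in> supported_on I"
  and supported_on_zero: "(\<lambda>i. 0) \<in> supported_on I"
  by (auto simp: supported_on_def)

lemmas supported_on_intros =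
  supported_on_add supported_on_scale supported_on_uminus supported_on_zero

text \<open>Homogeneity is only asked as an inequality, which is what infima deliver directly;
  applying it to \<open>1 / t\<close> gives the reverse inequality.\<close>

definition sublinear_on :: "'i set \<Rightarrow> (('i \<Rightarrow> complex) \<Rightarrow> real) \<Rightarrow> bool" where
  "sublinear_on I p \<longleftrightarrow>
    (\<forall>x\<in>supported_on I. \<forall>y\<in>supported_on I. p (\<lambda>i. x i + y i) \<le> p x + p y) \<and>
    (\<forall>x\<in>supported_on I. \<forall>t>0. p (\<lambda>i. of_real t * x i) \<le> t * p x)"

lemma sublinear_on_addD:
  "sublinear_on I p \<Longrightarrow> x \<in> supported_on I \<Longrightarrow> y \<in> supported_on I \<Longrightarrow> p (\<lambda>i. x i + y i) \<le> p x + p y"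
  by (simp add: sublinear_on_def)

lemma sublinear_on_scale:
  assumes p: "sublinear_on I p" and x: "x \<in> supported_on I" and t: "t > 0"
  shows "p (\<lambda>i. of_real t * x i) = t * p x"
proof (rule antisym)
  show "p (\<lambda>i. of_real t * x i) \<le> t * p x" using assms by (simp add: sublinear_on_def)
  have "p (\<lambda>i. of_real (inverse t) * (of_real t * x i)) \<le> inverse t * p (\<lambda>i. of_real t * x i)"
    using p t supported_on_scale[OF x] by (simp add: sublinear_on_def del: of_real_inverse)
  then show "t * p x \<le> p (\<lambda>i. of_real t * x i)" using t by (simp add: field_simps)
qed

lemma sublinear_on_0:
  assumes p: "sublinear_on I p"
  shows "p (\<lambda>i. 0) = 0"
  using sublinear_on_scale[OF p supported_on_zero, of 2] by simp

lemma sublinear_on_uminus: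
  assumes p: "sublinear_on I p" and x: "x \<in> supported_on I"
  shows "0 \<le> p x + p (\<lambda>i. - x i)"
  using sublinear_on_addD[OF p x supported_on_uminus[OF x]] sublinear_on_0[OF p] by simp

text \<open>Passing to the directional infimum makes a sublinear functional linear along one vector; a
  sublinear functional that is linear along a spanning set is linear, which gives Hahn-Banach.\<close>

lemma sublinear_on_linearize:
  assumes p: "sublinear_on I p" and e: "e \<in> supported_on I"
  obtains q where "sublinear_on I q" "\<And>x. x \<in> supported_on I \<Longrightarrow> q x \<le> p x"
    "q (\<lambda>i. - e i) = - q e" "q (\<lambda>i. - e i) \<le> - p e"
proof -
  \<comment> \<open>A linear functional below \<open>p\<close> that agrees with \<open>p\<close> at
    \<open>e\<close> is bounded at \<open>x\<close> by \<open>a x t\<close> for every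
    \<open>t\<close>, so the infimum is the natural candidate for \<open>q\<close>.\<close>
  define a where "a x t = p (\<lambda>i. x i + of_real t * e i) - t * p e" for x t
  define q where "q x = (INF t\<in>{0<..}. a x t)" for x
  have et: "p (\<lambda>i. of_real t * e i) = t * p e" if "t > 0" for t
    using sublinear_on_scale[OF p e that] .
  have lower: "- p (\<lambda>i. - x i) \<le> a x t" if x: "x \<in> supported_on I" and t: "t > 0" for x t
  proof -
    have "p (\<lambda>i. (x i + of_real t * e i) + - x i) \<le> p (\<lambda>i. x i + of_real t * e i) + p (\<lambda>i. - x i)"
      using x e by (intro sublinear_on_addD[OF p] supported_on_intros)
    then show ?thesis using et[OF t] by (simp add: a_def)
  qed
  have bdd: "bdd_below (a x ` {0<..})" if "x \<in> supported_on I" for x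
    using lower[OF that] by (intro bdd_belowI2) auto
  have q_le: "q x \<le> a x t" if "x \<in> supported_on I" "t > 0" for x t
    unfolding q_def by (rule cINF_lower) (use bdd that in auto)
  have q_ge: "c \<le> q x" if "\<And>t. t > 0 \<Longrightarrow> c \<le> a x t" for c x
    unfolding q_def by (rule cINF_greatest) (use that in auto)
  have add: "q (\<lambda>i. x i + y i) \<le> q x + q y" if x: "x \<in> supported_on I" and y: "y \<in> supported_on I" for x y
  proof -
    have *: "q (\<lambda>i. x i + y i) \<le> a x s + a y t" if s: "s > 0" and t: "t > 0" for s t
    proof -
      have "q (\<lambda>i. x i + y i) \<le> a (\<lambda>i. x i + y i) (s + t)"
        using x y s t by (intro q_le supported_on_intros) auto
      also have "(\<lambda>i. (x i + y i) + of_real (s + t) * e i) =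
          (\<lambda>i. (x i + of_real s * e i) + (y i + of_real t * e i))"
        by (simp add: algebra_simps)
      then have "a (\<lambda>i. x i + y i) (s + t) \<le> a x s + a y t"
        unfolding a_def
        using sublinear_on_addD[OF p, of "\<lambda>i. x i + of_real s * e i" "\<lambda>i. y i + of_real t * e i"] x y e
        by (simp add: supported_on_intros algebra_simps)
      finally show ?thesis .
    qed
    have "q (\<lambda>i. x i + y i) - a y t \<le> q x" if "t > 0" for t
      by (rule q_ge) (use *[OF _ that] in \<open>simp add: algebra_simps\<close>)
    then have "q (\<lambda>i. x i + y i) - q x \<le> q y"
      by (intro q_ge) (simp add: algebra_simps)
    then show ?thesis by simp
  qed
  have scale: "q (\<lambda>i. of_real t * x i) \<le> t * q x" if x: "x \<in> supported_on I" and t: "t > 0" for x t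
  proof -
    have "q (\<lambda>i. of_real t * x i) / t \<le> q x"
    proof (rule q_ge)
      fix s :: real assume s: "s > 0"
      have "q (\<lambda>i. of_real t * x i) \<le> a (\<lambda>i. of_real t * x i) (t * s)"
        using x s t by (intro q_le supported_on_intros) auto
      also have "\<dots> = t * a x s"
        using sublinear_on_scale[OF p, of "\<lambda>i. x i + of_real s * e i" t] x e t
        by (simp add: a_def supported_on_intros algebra_simps)
      finally show "q (\<lambda>i. of_real t * x i) / t \<le> a x s" using t by (simp add: field_simps)
    qed
    then show ?thesis using t by (simp add: field_simps)
  qed
  have sub: "sublinear_on I q" using add scale by (simp add: sublinear_on_def)
  have le: "q x \<le> p x" if x: "x \<in> supported_on I" for x
  proof -
    have "q x \<le> a x 1" using q_le[OF x] by simp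
    also have "\<dots> \<le> p x" using sublinear_on_addD[OF p x e] by (simp add: a_def)
    finally show ?thesis .
  qed
  have "q (\<lambda>i. - e i) \<le> a (\<lambda>i. - e i) 1" using q_le[OF supported_on_uminus[OF e]] by simp
  also have "\<dots> = - p e" using sublinear_on_0[OF p] by (simp add: a_def)
  finally have neg: "q (\<lambda>i. - e i) \<le> - p e" .
  moreover have "q (\<lambda>i. - e i) = - q e"
    using neg le[OF e] sublinear_on_uminus[OF sub e] by linarith
  ultimately show thesis using that sub le by blast
qed

text \<open>Linearity along a vector survives later steps: if r is below q, then r(f) + r(-f) is at
  most q(f) + q(-f) = 0, and sublinearity makes it nonnegative.\<close>

lemma sublinear_on_linearize_finite:
  assumes p: "sublinear_on I p" and E: "finite E" "E \<subseteq> supported_on I"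
  obtains q where "sublinear_on I q" "\<And>x. x \<in> supported_on I \<Longrightarrow> q x \<le> p x"
    "\<And>e. e \<in> E \<Longrightarrow> q (\<lambda>i. - e i) = - q e"
proof -
  from E have "\<exists>q. sublinear_on I q \<and> (\<forall>x\<in>supported_on I. q x \<le> p x) \<and> (\<forall>e\<in>E. q (\<lambda>i. - e i) = - q e)"
  proof (induction E rule: finite_induct)
    case empty
    then show ?case using p by auto
  next
    case (insert e E)
    then obtain q where q: "sublinear_on I q" "\<forall>x\<in>supported_on I. q x \<le> p x" "\<forall>e\<in>E. q (\<lambda>i. - e i) = - q e"
      by auto
    from insert.prems have e: "e \<in> supported_on I" by simp
    obtain r where r: "sublinear_on I r" "\<And>x. x \<in> supported_on I \<Longrightarrow> r x \<le> q x" "r (\<lambda>i. - e i) = - r e"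
      using sublinear_on_linearize[OF q(1) e] by metis
    have "r (\<lambda>i. - f i) = - r f" if "f \<in> E" for f
      using r(2)[of f] r(2)[of "\<lambda>i. - f i"] q(3) that insert.prems sublinear_on_uminus[OF r(1), of f]
      by (fastforce simp: supported_on_intros)
    with r q show ?case by (intro exI[of _ r]) force
  qed
  with that show thesis by blast
qed

text \<open>Linearizing along \<open>x0\<close> first fixes the value there at \<open>p x0\<close>;
  afterwards the real basis formed by the unit vectors and their multiples by \<open>\<i>\<close> is
  treated, and the value at \<open>x0\<close> cannot change any more.\<close>

lemma hahn_banach_coordinates:
  fixes p :: "('i \<Rightarrow> complex) \<Rightarrow> real"
  assumes I: "finite I" and p: "sublinear_on I p" and x0: "x0 \<in> supported_on I"
  obtains c where "\<And>x. x \<in> supported_on I \<Longrightarrow> Re (\<Sum>i\<in>I. c i * x i) \<le> p x"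
    and "Re (\<Sum>i\<in>I. c i * x0 i) = p x0"
proof -
  obtain p1 where p1: "sublinear_on I p1" "\<And>x. x \<in> supported_on I \<Longrightarrow> p1 x \<le> p x"
      "p1 (\<lambda>i. - x0 i) \<le> - p x0"
    using sublinear_on_linearize[OF p x0] by metis
  define b where "b z i = (\<lambda>l. if l = i then z else 0)" for z :: complex and i :: 'i
  have b: "b z i \<in> supported_on I" if "i \<in> I" for z i using that by (auto simp: b_def supported_on_def)
  obtain q where q: "sublinear_on I q" "\<And>x. x \<in> supported_on I \<Longrightarrow> q x \<le> p1 x"
    and lin: "\<And>e. e \<in> b 1 ` I \<union> b \<i> ` I \<Longrightarrow> q (\<lambda>i. - e i) = - q e"
    using sublinear_on_linearize_finite[OF p1(1), of "b 1 ` I \<union> b \<i> ` I"] I b by blast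
  \<comment> \<open>The lineality space of \<open>q\<close>: a real subspace on which
    \<open>q\<close> is linear. It contains a real basis, hence everything supported on
    \<open>I\<close>.\<close>
  define L where "L = {e \<in> supported_on I. q (\<lambda>i. - e i) = - q e}"
  have add: "q (\<lambda>i. e i + y i) = q e + q y" if e: "e \<in> L" and y: "y \<in> supported_on I" for e y
  proof (rule antisym)
    have es: "e \<in> supported_on I" using e by (simp add: L_def)
    show "q (\<lambda>i. e i + y i) \<le> q e + q y" by (rule sublinear_on_addD[OF q(1) es y])
    have "q (\<lambda>i. (e i + y i) + - e i) \<le> q (\<lambda>i. e i + y i) + q (\<lambda>i. - e i)"
      by (intro sublinear_on_addD[OF q(1)] supported_on_intros es y)
    then show "q e + q y \<le> q (\<lambda>i. e i + y i)" using e by (simp add: L_def)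
  qed
  have L0: "(\<lambda>i. 0) \<in> L" using sublinear_on_0[OF q(1)] by (simp add: L_def supported_on_zero)
  have L_neg: "(\<lambda>i. - e i) \<in> L" if "e \<in> L" for e
    using that by (simp add: L_def supported_on_intros)
  have L_add: "(\<lambda>i. e i + f i) \<in> L" if e: "e \<in> L" and f: "f \<in> L" for e f
    using add[OF e, of f] add[OF L_neg[OF e], of "\<lambda>i. - f i"] e f by (simp add: L_def supported_on_intros)
  have scale: "(\<lambda>i. of_real t * e i) \<in> L \<and> q (\<lambda>i. of_real t * e i) = t * q e" if e: "e \<in> L" for t e
  proof -
    have pos: "(\<lambda>i. of_real t * e i) \<in> L \<and> q (\<lambda>i. of_real t * e i) = t * q e" if e: "e \<in> L" and t: "t > 0" for t e
      using sublinear_on_scale[OF q(1) _ t, of e] sublinear_on_scale[OF q(1) _ t, of "\<lambda>i. - e i"] e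
      by (simp add: L_def supported_on_intros)
    consider "t > 0" | "t = 0" | "t < 0" by linarith
    then show ?thesis
    proof cases
      case 3
      then show ?thesis using pos[OF L_neg[OF e], of "-t"] e by (simp add: L_def)
    qed (use pos e L0 sublinear_on_0[OF q(1)] in auto)
  qed
  \<comment> \<open>The minus sign makes \<open>Re (c i * z)\<close> equal to
    \<open>Re z * q (b 1 i) + Im z * q (b \<i> i)\<close>, so a real-linear functional becomes the
    real part of a complex-linear one.\<close>
  define c where "c i = Complex (q (b 1 i)) (- q (b \<i> i))" for i
  have bz: "b z i \<in> L \<and> q (b z i) = Re (c i * z)" if i: "i \<in> I" for z i
  proof -
    have L1: "b 1 i \<in> L" and Li: "b \<i> i \<in> L" using lin i b by (auto simp: L_def)
    have eq: "b z i = (\<lambda>l. of_real (Re z) * b 1 i l + of_real (Im z) * b \<i> i l)"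
      by (auto simp: b_def complex_eq_iff)
    have 1: "(\<lambda>l. of_real (Re z) * b 1 i l) \<in> L" "q (\<lambda>l. of_real (Re z) * b 1 i l) = Re z * q (b 1 i)"
      using scale[OF L1] by auto
    have 2: "(\<lambda>l. of_real (Im z) * b \<i> i l) \<in> L" "q (\<lambda>l. of_real (Im z) * b \<i> i l) = Im z * q (b \<i> i)"
      using scale[OF Li] by auto
    have "b z i \<in> L" unfolding eq by (rule L_add[OF 1(1) 2(1)])
    moreover have "q (b z i) = Re (c i * z)" unfolding eq
      using add[OF 1(1), of "\<lambda>l. of_real (Im z) * b \<i> i l"] 1 2 by (simp add: L_def c_def)
    ultimately show ?thesis ..
  qed
  have part: "(\<lambda>i. if i \<in> J then x i else 0) \<in> L \<and> q (\<lambda>i. if i \<in> J then x i else 0) = Re (\<Sum>i\<in>J. c i * x i)"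
    if "finite J" "J \<subseteq> I" for J x
    using that
  proof (induction J rule: finite_induct)
    case empty
    then show ?case using L0 sublinear_on_0[OF q(1)] by simp
  next
    case (insert k J)
    have eq: "(\<lambda>i. if i \<in> insert k J then x i else 0) = (\<lambda>i. b (x k) k i + (if i \<in> J then x i else 0))"
      using insert.hyps by (auto simp: b_def)
    from insert have IH: "(\<lambda>i. if i \<in> J then x i else 0) \<in> L" "q (\<lambda>i. if i \<in> J then x i else 0) = Re (\<Sum>i\<in>J. c i * x i)"
      by auto
    have bk: "b (x k) k \<in> L" "q (b (x k) k) = Re (c k * x k)" using bz insert.prems by auto
    show ?case unfolding eq
      using L_add[OF bk(1) IH(1)] add[OF bk(1), of "\<lambda>i. if i \<in> J then x i else 0"] IH bk insert.hyps
      by (simp add: L_def)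
  qed
  have val: "x \<in> L \<and> q x = Re (\<Sum>i\<in>I. c i * x i)" if "x \<in> supported_on I" for x
  proof -
    have "(\<lambda>i. if i \<in> I then x i else 0) = x" using that by (auto simp: supported_on_def)
    then show ?thesis using part[OF I, of x] by simp
  qed
  show thesis
  proof
    show le: "Re (\<Sum>i\<in>I. c i * x i) \<le> p x" if "x \<in> supported_on I" for x
      using val[OF that] q(2)[OF that] p1(2)[OF that] by simp
    have "q (\<lambda>i. - x0 i) = - q x0" using val[OF x0] by (simp add: L_def)
    then have "p x0 \<le> q x0" using q(2)[OF supported_on_uminus[OF x0]] p1(3) by simp
    then show "Re (\<Sum>i\<in>I. c i * x0 i) = p x0"
      using val[OF x0] le[OF x0] by simp
  qed
qed

text \<open>Hahn-Banach is applied to the Minkowski gauge of \<open>D\<close>. The condition on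
  multiples \<open>t > 1\<close> says exactly that the gauge of \<open>x0\<close> is at least 1, so
  \<open>x0\<close> may lie in \<open>D\<close> or on its edge.\<close>

lemma separation_coordinates:
  fixes D :: "('i \<Rightarrow> complex) set"
  assumes I: "finite I" and x0: "x0 \<in> supported_on I"
    and conv: "\<And>x y t. x \<in> D \<Longrightarrow> y \<in> D \<Longrightarrow> 0 < t \<Longrightarrow> t < 1 \<Longrightarrow>
      (\<lambda>i. of_real t * x i + of_real (1 - t) * y i) \<in> D"
    and absorb: "\<And>x. x \<in> supported_on I \<Longrightarrow> \<exists>t>0. (\<lambda>i. of_real t * x i) \<in> D"
    and out: "\<And>t. t > 1 \<Longrightarrow> (\<lambda>i. of_real t * x0 i) \<notin> D"
  obtains c where "\<And>x. x \<in> D \<Longrightarrow> x \<in> supported_on I \<Longrightarrow> Re (\<Sum>i\<in>I. c i * x i) \<le> 1"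
    and "Re (\<Sum>i\<in>I. c i * x0 i) \<ge> 1"
proof -
  define G where "G x = {t. t > 0 \<and> (\<lambda>i. of_real (1 / t) * x i) \<in> D}" for x
  define p where "p x = Inf (G x)" for x
  have bdd: "bdd_below (G x)" for x by (rule bdd_belowI[of _ 0]) (auto simp: G_def)
  have ne: "G x \<noteq> {}" if x: "x \<in> supported_on I" for x
  proof -
    obtain t where "t > 0" "(\<lambda>i. of_real t * x i) \<in> D" using absorb[OF x] by blast
    then have "1 / t \<in> G x" by (simp add: G_def divide_simps mult.commute)
    then show ?thesis by blast
  qed
  have le: "p x \<le> t" if "t \<in> G x" for x t unfolding p_def by (rule cInf_lower[OF that bdd])
  have ge: "s \<le> p x" if "x \<in> supported_on I" "\<And>t. t \<in> G x \<Longrightarrow> s \<le> t" for x s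
    unfolding p_def by (rule cInf_greatest[OF ne]) (use that in auto)
  have add: "p (\<lambda>i. x i + y i) \<le> p x + p y" if x: "x \<in> supported_on I" and y: "y \<in> supported_on I" for x y
  proof -
    have *: "p (\<lambda>i. x i + y i) \<le> s + t" if s: "s \<in> G x" and t: "t \<in> G y" for s t
    proof (rule le)
      have st: "s > 0" "t > 0" using s t by (auto simp: G_def)
      \<comment> \<open>The weights s/(s+t) and t/(s+t) combine x/s and y/t to (x+y)/(s+t).\<close>
      have "(\<lambda>i. of_real (s / (s + t)) * (of_real (1 / s) * x i) +
          of_real (1 - s / (s + t)) * (of_real (1 / t) * y i)) \<in> D"
        using s t st by (intro conv) (auto simp: G_def)
      also have "(\<lambda>i. of_real (s / (s + t)) * (of_real (1 / s) * x i) +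
          of_real (1 - s / (s + t)) * (of_real (1 / t) * y i)) = (\<lambda>i. of_real (1 / (s + t)) * (x i + y i))"
      proof
        fix i
        have 1: "complex_of_real (s / (s + t)) * of_real (1 / s) = of_real (1 / (s + t))"
          unfolding of_real_mult[symmetric] using st by simp
        have "(1 - s / (s + t)) * (1 / t) = 1 / (s + t)" using st by (simp add: field_simps)
        then have 2: "complex_of_real (1 - s / (s + t)) * of_real (1 / t) = of_real (1 / (s + t))"
          unfolding of_real_mult[symmetric] by simp
        show "of_real (s / (s + t)) * (of_real (1 / s) * x i) +
          of_real (1 - s / (s + t)) * (of_real (1 / t) * y i) = of_real (1 / (s + t)) * (x i + y i)"
          unfolding mult.assoc[symmetric] 1 2 by (simp add: distrib_left)
      qed
      finally show "s + t \<in> G (\<lambda>i. x i + y i)" using st by (simp add: G_def)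
    qed
    have "p (\<lambda>i. x i + y i) - t \<le> p x" if "t \<in> G y" for t
      by (rule ge[OF x]) (use *[OF _ that] in \<open>simp add: algebra_simps\<close>)
    then have "p (\<lambda>i. x i + y i) - p x \<le> p y"
      by (intro ge[OF y]) (simp add: algebra_simps)
    then show ?thesis by simp
  qed
  have scale: "p (\<lambda>i. of_real t * x i) \<le> t * p x" if x: "x \<in> supported_on I" and t: "t > 0" for x t
  proof -
    have "p (\<lambda>i. of_real t * x i) / t \<le> p x"
    proof (rule ge[OF x])
      fix s assume "s \<in> G x"
      then have "t * s \<in> G (\<lambda>i. of_real t * x i)" using t by (simp add: G_def)
      then show "p (\<lambda>i. of_real t * x i) / t \<le> s" using le t by (simp add: field_simps)
    qed
    then show ?thesis using t by (simp add: field_simps)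
  qed
  have "sublinear_on I p" using add scale by (simp add: sublinear_on_def)
  then obtain c where c: "\<And>x. x \<in> supported_on I \<Longrightarrow> Re (\<Sum>i\<in>I. c i * x i) \<le> p x"
    "Re (\<Sum>i\<in>I. c i * x0 i) = p x0"
    using hahn_banach_coordinates[OF I _ x0] by metis
  show thesis
  proof
    fix x assume x: "x \<in> D" "x \<in> supported_on I"
    then have "1 \<in> G x" by (simp add: G_def)
    then show "Re (\<Sum>i\<in>I. c i * x i) \<le> 1" using c(1)[OF x(2)] le by fastforce
  next
    have "1 \<le> p x0"
    proof (rule ge[OF x0])
      fix t assume "t \<in> G x0"
      then have t: "t > 0" "(\<lambda>i. of_real (1 / t) * x0 i) \<in> D" by (auto simp: G_def)
      then have "\<not> 1 / t > 1" using out by blast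
      then show "1 \<le> t" using t(1) by (simp add: field_simps)
    qed
    then show "Re (\<Sum>i\<in>I. c i * x0 i) \<ge> 1" using c(2) by simp
  qed
qed

section \<open>Semi-inner products on coordinate space\<close>

definition sesq :: "nat \<Rightarrow> (nat \<Rightarrow> nat \<Rightarrow> complex) \<Rightarrow> (nat \<Rightarrow> complex) \<Rightarrow> (nat \<Rightarrow> complex) \<Rightarrow> complex" where
  "sesq n T x y = (\<Sum>k<n. \<Sum>l<n. T k l * cnj (x k) * y l)"

locale semi_inner_product =
  fixes n :: nat and T :: "nat \<Rightarrow> nat \<Rightarrow> complex"
  assumes hermitian: "T k l = cnj (T l k)"
    and nonneg: "0 \<le> Re (sesq n T x x)"
begin

abbreviation B where "B \<equiv> sesq n T"

lemma B_add_right: "B x (\<lambda>l. y l + z l) = B x y + B x z"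
  by (simp add: sesq_def distrib_left sum.distrib)

lemma B_scale_right: "B x (\<lambda>l. c * y l) = c * B x y"
  by (simp add: sesq_def sum_distrib_left mult.left_commute)

lemma B_zero_right: "B x (\<lambda>l. 0) = 0"
  by (simp add: sesq_def)

lemma B_sum_right: "finite A \<Longrightarrow> B x (\<lambda>l. \<Sum>a\<in>A. c a * y a l) = (\<Sum>a\<in>A. c a * B x (y a))"
  by (induction A rule: finite_induct) (auto simp: B_add_right B_scale_right B_zero_right)

lemma B_cnj: "cnj (B x y) = B y x"
proof -
  have "cnj (B x y) = (\<Sum>k<n. \<Sum>l<n. T l k * x k * cnj (y l))"
    unfolding sesq_def cnj_sum
    by (intro sum.cong refl) (simp add: hermitian[symmetric])
  also have "\<dots> = B y x"
    unfolding sesq_def by (subst sum.swap) (simp add: mult_ac)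
  finally show ?thesis .
qed

lemma B_add_left: "B (\<lambda>l. y l + z l) x = B y x + B z x"
  by (metis B_add_right B_cnj complex_cnj_add)

lemma B_scale_left: "B (\<lambda>l. c * y l) x = cnj c * B y x"
  by (metis B_scale_right B_cnj complex_cnj_mult)

lemma B_zero_left: "B (\<lambda>l. 0) x = 0"
  by (simp add: sesq_def)

lemma B_self_real: "B x x = of_real (Re (B x x))"
  using B_cnj[of x x] by (simp add: complex_eq_iff)

lemma B_null_right:
  assumes z: "B z z = 0"
  shows "B y z = 0"
proof (rule ccontr)
  assume nz: "B y z \<noteq> 0"
  \<comment> \<open>For this \<open>c\<close> the form at \<open>y + c z\<close> equals \<open>-1\<close>.\<close>
  define s where "s = (Re (B y y) + 1) / (2 * (cmod (B y z))\<^sup>2)"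
  define c where "c = - (of_real s * cnj (B y z))"
  have "0 \<le> Re (B (\<lambda>l. y l + c * z l) (\<lambda>l. y l + c * z l))" by (rule nonneg)
  also have "B (\<lambda>l. y l + c * z l) (\<lambda>l. y l + c * z l) = B y y + c * B y z + cnj c * B z y"
    using z by (simp add: B_add_left B_add_right B_scale_left B_scale_right)
  also have "c * B y z = - of_real (s * (cmod (B y z))\<^sup>2)"
    by (simp add: c_def complex_norm_square del: of_real_power)
  also have "cnj c * B z y = - of_real (s * (cmod (B y z))\<^sup>2)"
    using B_cnj[of y z] B_cnj[of z y] by (simp add: c_def complex_norm_square mult.commute del: of_real_power)
  also have "s * (cmod (B y z))\<^sup>2 = (Re (B y y) + 1) / 2"
    using nz by (simp add: s_def)
  finally show False by simp
qed

definition partial_orthonormal :: "nat \<Rightarrow> (nat \<Rightarrow> nat \<Rightarrow> complex) \<Rightarrow> bool" where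
  "partial_orthonormal k u \<longleftrightarrow>
    (\<forall>a<k. \<forall>b<k. a \<noteq> b \<longrightarrow> B (u a) (u b) = 0) \<and> (\<forall>a<k. u a = (\<lambda>l. 0) \<or> B (u a) (u a) = 1)"

definition residual :: "nat \<Rightarrow> (nat \<Rightarrow> nat \<Rightarrow> complex) \<Rightarrow> (nat \<Rightarrow> complex) \<Rightarrow> nat \<Rightarrow> complex" where
  "residual k u x = (\<lambda>l. x l - (\<Sum>a<k. B (u a) x * u a l))"

lemma B_orthonormal_residual:
  assumes u: "partial_orthonormal k u" and b: "b < k"
  shows "B (u b) (residual k u x) = 0"
proof -
  have "residual k u x = (\<lambda>l. x l + (-1) * (\<Sum>a<k. B (u a) x * u a l))" by (simp add: residual_def)
  then have "B (u b) (residual k u x) = B (u b) x - (\<Sum>a<k. B (u a) x * B (u b) (u a))"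
    by (simp only: B_add_right B_scale_right B_sum_right finite_lessThan) simp
  also have "(\<Sum>a<k. B (u a) x * B (u b) (u a)) = (\<Sum>a<k. if a = b then B (u b) x * B (u b) (u b) else 0)"
    using u b by (intro sum.cong refl) (auto simp: partial_orthonormal_def)
  also have "\<dots> = B (u b) x" using u b
    by (auto simp: partial_orthonormal_def B_zero_left)
  finally show ?thesis by simp
qed

lemma B_orthonormal_combination:
  assumes u: "partial_orthonormal k u"
  shows "B (\<lambda>l. \<Sum>a<k. d a * u a l) (\<lambda>l. \<Sum>a<k. d a * u a l) = (\<Sum>a<k. of_real ((cmod (d a))\<^sup>2) * B (u a) (u a))"
proof -
  have 1: "B (u b) (\<lambda>l. \<Sum>a<k. d a * u a l) = d b * B (u b) (u b)" if b: "b < k" for b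
  proof -
    have "B (u b) (\<lambda>l. \<Sum>a<k. d a * u a l) = (\<Sum>a<k. if a = b then d b * B (u b) (u b) else 0)"
      unfolding B_sum_right[OF finite_lessThan] using u b
      by (intro sum.cong refl) (auto simp: partial_orthonormal_def)
    then show ?thesis using b by simp
  qed
  have 2: "B (\<lambda>l. \<Sum>a<k. d a * u a l) (u b) = cnj (d b) * B (u b) (u b)" if "b < k" for b
    using arg_cong[OF 1[OF that], of cnj] by (simp add: B_cnj)
  show ?thesis
    unfolding B_sum_right[OF finite_lessThan]
    by (intro sum.cong refl) (simp add: 2 complex_norm_square mult_ac del: of_real_power)
qed

lemma bessel:
  assumes u: "partial_orthonormal k u"
  shows "(\<Sum>a<k. (cmod (B (u a) x))\<^sup>2) \<le> Re (B x x)"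
proof -
  define s where "s = (\<lambda>l. \<Sum>a<k. B (u a) x * u a l)"
  define z where "z = residual k u x"
  have x: "x = (\<lambda>l. z l + s l)" by (simp add: z_def s_def residual_def)
  have zs: "B z s = 0"
    unfolding s_def B_sum_right[OF finite_lessThan]
    using B_orthonormal_residual[OF u, of _ x] B_cnj[of _ z]
    by (intro sum.neutral) (metis z_def complex_cnj_zero lessThan_iff mult_zero_right)
  then have sz: "B s z = 0" using B_cnj[of z s] by simp
  have "B x x = B z z + B s s"
    by (subst (1 2) x) (simp add: B_add_left B_add_right zs sz)
  moreover have "B s s = of_real (\<Sum>a<k. (cmod (B (u a) x))\<^sup>2)"
    unfolding s_def B_orthonormal_combination[OF u] of_real_sum
    using u by (intro sum.cong refl) (auto simp: partial_orthonormal_def B_zero_left)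
  ultimately show ?thesis using nonneg[of z] by simp
qed

text \<open>A degenerate form can only make the residuals null, not zero. Each step appends the
  normalized residual of \<open>e k\<close>, or the zero vector if that residual is already
  null.\<close>

lemma gram_schmidt:
  "\<exists>u. partial_orthonormal k u \<and> (\<forall>i<k. B (residual k u (e i)) (residual k u (e i)) = 0)"
proof (induction k)
  case 0
  show ?case by (simp add: partial_orthonormal_def)
next
  case (Suc k)
  then obtain u where u: "partial_orthonormal k u"
    and null: "\<And>i. i < k \<Longrightarrow> B (residual k u (e i)) (residual k u (e i)) = 0" by blast
  define z where "z = residual k u (e k)"
  define r where "r = sqrt (Re (B z z))"
  define c where "c = complex_of_real (1 / r)"
  have cnj_c: "cnj c = c" by (simp add: c_def)
  define w where "w = (if B z z = 0 then (\<lambda>l. 0) else (\<lambda>l. c * z l))"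
  define u' where "u' = u(k := w)"
  have r: "of_real r * of_real r = B z z"
    using nonneg[of z] B_self_real[of z] by (simp add: r_def flip: of_real_mult)
  have residual_cong: "residual k u' x = residual k u x" for x
    by (simp add: residual_def u'_def)
  have residual_Suc: "residual (Suc k) u' x = (\<lambda>l. residual k u x l - B w x * w l)" for x
    by (simp add: residual_def u'_def algebra_simps)
  have Buw: "B (u a) w = 0" "B w (u a) = 0" if a: "a < k" for a
  proof -
    have "B (u a) z = 0" unfolding z_def by (rule B_orthonormal_residual[OF u a])
    then show *: "B (u a) w = 0"
      by (simp add: w_def B_zero_right B_scale_right)
    show "B w (u a) = 0" using B_cnj[of "u a" w] * by simp
  qed
  have ww: "w = (\<lambda>l. 0) \<or> B w w = 1"
  proof (cases "B z z = 0")
    case False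
    have "B w w = c * c * B z z"
      using False by (simp add: w_def B_scale_left B_scale_right cnj_c)
    also have "\<dots> = 1" unfolding r[symmetric] c_def using False r by auto
    finally show ?thesis ..
  qed (simp add: w_def)
  have po: "partial_orthonormal (Suc k) u'"
    using u Buw ww by (auto simp: partial_orthonormal_def u'_def less_Suc_eq)
  have split: "B w x = B w (residual k u x)" for x
  proof -
    have "x = (\<lambda>l. residual k u x l + (\<Sum>a<k. B (u a) x * u a l))" by (simp add: residual_def)
    then have "B w x = B w (\<lambda>l. residual k u x l + (\<Sum>a<k. B (u a) x * u a l))" by (rule arg_cong)
    also have "\<dots> = B w (residual k u x) + (\<Sum>a<k. B (u a) x * B w (u a))"
      by (simp only: B_add_right B_sum_right finite_lessThan)
    finally have "B w x = B w (residual k u x) + (\<Sum>a<k. B (u a) x * B w (u a))" .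
    then show ?thesis using Buw by simp
  qed
  have "B (residual (Suc k) u' (e i)) (residual (Suc k) u' (e i)) = 0" if i: "i < Suc k" for i
  proof (cases "i = k")
    case True
    show ?thesis
    proof (cases "B z z = 0")
      case True
      then show ?thesis using \<open>i = k\<close> by (simp add: residual_Suc w_def z_def[symmetric])
    next
      case False
      then have r0: "r \<noteq> 0" using r by auto
      have "B w (e k) = c * B z z"
        using False split[of "e k"] by (simp add: w_def z_def[symmetric] B_scale_left cnj_c)
      also have "\<dots> = of_real r" using r0 by (simp add: r[symmetric] c_def)
      finally have "residual (Suc k) u' (e k) = (\<lambda>l. 0)"
        using False r0 by (simp add: residual_Suc w_def z_def[symmetric] c_def)
      then show ?thesis using \<open>i = k\<close> by (simp add: B_zero_left)
    qed
  next
    case False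
    then have "i < k" using i by simp
    \<comment> \<open>The old residual is null, hence orthogonal to everything including
      \<open>w\<close>; so earlier residuals are not altered by the new vector.\<close>
    then have "B w (e i) = 0" using split[of "e i"] B_null_right[OF null] by simp
    then show ?thesis using null[OF \<open>i < k\<close>] by (simp add: residual_Suc)
  qed
  with po show ?case by blast
qed

text \<open>A substitute for a square root of the form and its inverse: x is sent to its coordinates
  \<open>B (u a) x\<close>, and d back to the combination of the \<open>u a\<close>. Neither map
  increases lengths, and the round trip fixes each \<open>e i\<close> modulo null vectors.\<close>

lemma gram_schmidt_factorization:
  obtains u where
    "\<forall>d. Re (B (\<lambda>l. \<Sum>a<n. d a * u a l) (\<lambda>l. \<Sum>a<n. d a * u a l)) \<le> (\<Sum>a<n. (cmod (d a))\<^sup>2)"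
    "\<forall>x. (\<Sum>a<n. (cmod (B (u a) x))\<^sup>2) \<le> Re (B x x)"
    "\<forall>i<n. B (\<lambda>l. e i l - (\<Sum>a<n. B (u a) (e i) * u a l)) (\<lambda>l. e i l - (\<Sum>a<n. B (u a) (e i) * u a l)) = 0"
proof -
  obtain u where u: "partial_orthonormal n u" "\<And>i. i < n \<Longrightarrow> B (residual n u (e i)) (residual n u (e i)) = 0"
    using gram_schmidt[of n e] by blast
  show thesis
  proof (rule that, rule allI)
    fix d
    have "Re (B (\<lambda>l. \<Sum>a<n. d a * u a l) (\<lambda>l. \<Sum>a<n. d a * u a l)) = (\<Sum>a<n. (cmod (d a))\<^sup>2 * Re (B (u a) (u a)))"
      by (simp add: B_orthonormal_combination[OF u(1)] del: of_real_power)
    also have "\<dots> \<le> (\<Sum>a<n. (cmod (d a))\<^sup>2)"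
      using u(1) by (intro sum_mono) (auto simp: partial_orthonormal_def B_zero_left)
    finally show "Re (B (\<lambda>l. \<Sum>a<n. d a * u a l) (\<lambda>l. \<Sum>a<n. d a * u a l)) \<le> (\<Sum>a<n. (cmod (d a))\<^sup>2)" .
  qed (use u(2) bessel[OF u(1)] in \<open>auto simp: residual_def\<close>)
qed

end

section \<open>Matrix balanced families\<close>

text \<open>Vectors and rectangular matrices are functions on the naturals with sizes passed
  separately, and only indices below the sizes are read. A row of a matrix is then a plain
  application \<open>c b\<close>, and stacking needs no carrier conditions.\<close>

definition sq_norm :: "nat \<Rightarrow> (nat \<Rightarrow> complex) \<Rightarrow> real" where
  "sq_norm n v = (\<Sum>k<n. (cmod (v k))\<^sup>2)"

definition apply_mat :: "nat \<Rightarrow> (nat \<Rightarrow> nat \<Rightarrow> complex) \<Rightarrow> (nat \<Rightarrow> complex) \<Rightarrow> nat \<Rightarrow> complex" where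
  "apply_mat n c v b = (\<Sum>k<n. c b k * v k)"

definition contraction :: "nat \<Rightarrow> nat \<Rightarrow> (nat \<Rightarrow> nat \<Rightarrow> complex) \<Rightarrow> bool" where
  "contraction m n c \<longleftrightarrow> (\<forall>v. sq_norm m (apply_mat n c v) \<le> sq_norm n v)"

text \<open>The entries of C2^* Y_j C1.\<close>

definition sandwich :: "nat \<Rightarrow> (nat \<Rightarrow> nat \<Rightarrow> complex) \<Rightarrow> ('g \<Rightarrow> complex mat) \<Rightarrow> (nat \<Rightarrow> nat \<Rightarrow> complex) \<Rightarrow>
    'g \<Rightarrow> nat \<Rightarrow> nat \<Rightarrow> complex" where
  "sandwich m c2 Y c1 j k l = (\<Sum>b<m. \<Sum>b'<m. cnj (c2 b k) * Y j $$ (b, b') * c1 b' l)"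

definition tuple_of :: "nat \<Rightarrow> ('g \<Rightarrow> nat \<Rightarrow> nat \<Rightarrow> complex) \<Rightarrow> 'g \<Rightarrow> complex mat" where
  "tuple_of n F j = mat n n (\<lambda>(k, l). F j k l)"

definition stack :: "nat \<Rightarrow> (nat \<Rightarrow> nat \<Rightarrow> complex) \<Rightarrow> (nat \<Rightarrow> nat \<Rightarrow> complex) \<Rightarrow> nat \<Rightarrow> nat \<Rightarrow> complex" where
  "stack m c d b = (if b < m then c b else d (b - m))"

definition direct_sum :: "nat \<Rightarrow> ('g \<Rightarrow> complex mat) \<Rightarrow> nat \<Rightarrow> ('g \<Rightarrow> complex mat) \<Rightarrow> 'g \<Rightarrow> complex mat" where
  "direct_sum n X m Y j = four_block_mat (X j) (0\<^sub>m n m) (0\<^sub>m m n) (Y j)"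

lemma sq_norm_nonneg: "0 \<le> sq_norm n v"
  by (simp add: sq_norm_def sum_nonneg)

lemma sq_norm_scale: "sq_norm n (\<lambda>k. c * v k) = (cmod c)\<^sup>2 * sq_norm n v"
  by (simp add: sq_norm_def norm_mult power_mult_distrib sum_distrib_left)

lemma sum_lessThan_add:
  fixes f :: "nat \<Rightarrow> 'a::comm_monoid_add"
  shows "(\<Sum>b<m + m'. f b) = (\<Sum>b<m. f b) + (\<Sum>b<m'. f (m + b))"
  by (induction m') (auto simp: add_ac)

lemma vec_norm_eq: "vec_norm v = sqrt (sq_norm (dim_vec v) (\<lambda>i. v $ i))"
  by (simp add: vec_norm_def sq_norm_def L2_set_def)

lemma vec_norm_le_1_iff: "vec_norm v \<le> 1 \<longleftrightarrow> sq_norm (dim_vec v) (\<lambda>i. v $ i) \<le> 1"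
  by (simp add: vec_norm_eq)

lemma mult_mat_vec_index:
  assumes "A \<in> carrier_mat m n" "v \<in> carrier_vec n" "b < m"
  shows "(A *\<^sub>v v) $ b = (\<Sum>k<n. A $$ (b, k) * v $ k)"
  using assms by (auto simp: scalar_prod_def lessThan_atLeast0 intro!: sum.cong)

lemma op_norm_contraction:
  assumes "contraction m n c"
  shows "op_norm (mat m n (\<lambda>(b, k). c b k)) \<le> 1"
proof (rule op_norm_le)
  fix v :: "complex Matrix.vec"
  assume v: "v \<in> carrier_vec (dim_col (mat m n (\<lambda>(b, k). c b k)))" "vec_norm v \<le> 1"
  have "sq_norm m (\<lambda>i. (mat m n (\<lambda>(b, k). c b k) *\<^sub>v v) $ i) = sq_norm m (apply_mat n c (\<lambda>i. v $ i))"
    unfolding sq_norm_def apply_mat_def using v(1)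
    by (intro sum.cong refl) (simp add: mult_mat_vec_index[of _ m n] del: index_mult_mat_vec)
  also have "\<dots> \<le> sq_norm n (\<lambda>i. v $ i)" using assms by (simp add: contraction_def)
  also have "\<dots> \<le> 1" using v by (simp add: vec_norm_le_1_iff)
  finally show "vec_norm (mat m n (\<lambda>(b, k). c b k) *\<^sub>v v) \<le> 1" by (simp add: vec_norm_le_1_iff)
qed

lemma tuple_of_sandwich:
  assumes Y: "Y \<in> mat_tuples m"
  shows "tuple_of n (sandwich m c2 Y c1) =
    (\<lambda>j. mat_adjoint (mat m n (\<lambda>(b, k). c2 b k)) * Y j * mat m n (\<lambda>(b, k). c1 b k))"
proof
  fix j
  have Yj: "Y j \<in> carrier_mat m m" using Y by (simp add: mat_tuples_def)
  define C1 C2 where "C1 = mat m n (\<lambda>(b, k). c1 b k)" and "C2 = mat m n (\<lambda>(b, k). c2 b k)"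
  have car: "C1 \<in> carrier_mat m n" "C2 \<in> carrier_mat m n" by (auto simp: C1_def C2_def)
  have adj: "mat_adjoint C2 \<in> carrier_mat n m"
    using car by (auto simp: mat_adjoint_def)
  have adj_index: "mat_adjoint C2 $$ (k, b) = cnj (c2 b k)" if "k < n" "b < m" for k b
    using that by (simp add: mat_adjoint_def C2_def mat_of_rows_index)
  show "tuple_of n (sandwich m c2 Y c1) j = mat_adjoint C2 * Y j * C1"
  proof (rule eq_matI)
    fix k l assume "k < dim_row (mat_adjoint C2 * Y j * C1)" "l < dim_col (mat_adjoint C2 * Y j * C1)"
    then have kl: "k < n" "l < n" using adj car by auto
    have "(mat_adjoint C2 * Y j * C1) $$ (k, l) = (\<Sum>b'<m. (\<Sum>b<m. cnj (c2 b k) * Y j $$ (b, b')) * c1 b' l)"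
      using kl adj car Yj
      by (auto simp: scalar_prod_def lessThan_atLeast0 adj_index C1_def intro!: sum.cong)
    also have "\<dots> = sandwich m c2 Y c1 j k l"
      unfolding sandwich_def by (simp add: sum_distrib_right) (rule sum.swap)
    finally show "tuple_of n (sandwich m c2 Y c1) j $$ (k, l) = (mat_adjoint C2 * Y j * C1) $$ (k, l)"
      using kl by (simp add: tuple_of_def)
  qed (use adj car in \<open>auto simp: tuple_of_def\<close>)
qed

lemma sq_norm_stack:
  "sq_norm (m + m') (apply_mat n (stack m c d) v) = sq_norm m (apply_mat n c v) + sq_norm m' (apply_mat n d v)"
  by (simp add: sq_norm_def sum_lessThan_add apply_mat_def stack_def)

lemma apply_mat_scale: "apply_mat n (\<lambda>b k. c * f b k) v = (\<lambda>b. c * apply_mat n f v b)"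
  by (auto simp: apply_mat_def sum_distrib_left mult_ac)

lemma sandwich_scale:
  "sandwich m (\<lambda>b k. of_real s * c2 b k) Y (\<lambda>b k. of_real t * c1 b k) j k l =
    of_real (s * t) * sandwich m c2 Y c1 j k l"
  by (simp add: sandwich_def sum_distrib_left mult_ac)

text \<open>The zero off-diagonal blocks remove all cross terms. Together with
  \<open>sq_norm_stack\<close> this makes stacking additive both in the compressed tuple and in the
  squared length, the source of both convexity arguments.\<close>

lemma sandwich_direct_sum:
  assumes Y: "Y \<in> mat_tuples m" and Z: "Z \<in> mat_tuples m'"
  shows "sandwich (m + m') (stack m c2 d2) (direct_sum m Y m' Z) (stack m c1 d1) j k l =
    sandwich m c2 Y c1 j k l + sandwich m' d2 Z d1 j k l"
proof -
  have "Y j \<in> carrier_mat m m" "Z j \<in> carrier_mat m' m'" using Y Z by (auto simp: mat_tuples_def)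
  then show ?thesis
    by (simp add: sandwich_def sum_lessThan_add stack_def direct_sum_def)
qed

lemma sandwich_identity:
  assumes "k < n" "l < n"
  shows "sandwich n (\<lambda>b k. if b = k then 1 else 0) X (\<lambda>b k. if b = k then 1 else 0) j k l = X j $$ (k, l)"
proof -
  have "sandwich n (\<lambda>b k. if b = k then 1 else 0) X (\<lambda>b k. if b = k then 1 else 0) j k l =
      (\<Sum>b<n. if b = k then \<Sum>b'<n. if b' = l then X j $$ (b, b') else 0 else 0)"
    unfolding sandwich_def by (intro sum.cong refl) (auto intro!: sum.cong simp del: sum.delta sum.delta')
  then show ?thesis using assms by simp
qed

section \<open>Homogeneity of norms and pencils\<close>

lemma op_norm_smult_le:
  assumes t: "t \<ge> 0"
  shows "op_norm (of_real t \<cdot>\<^sub>m A) \<le> t * op_norm A"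
proof (rule op_norm_le)
  fix v assume v: "v \<in> carrier_vec (dim_col (complex_of_real t \<cdot>\<^sub>m A))" "vec_norm v \<le> 1"
  have "sq_norm (dim_row A) (\<lambda>i. ((of_real t \<cdot>\<^sub>m A) *\<^sub>v v) $ i) = sq_norm (dim_row A) (\<lambda>i. of_real t * (A *\<^sub>v v) $ i)"
    unfolding sq_norm_def using v
    by (intro sum.cong refl)
      (simp add: mult_mat_vec_index[of _ "dim_row A" "dim_col A"] sum_distrib_left mult_ac del: index_mult_mat_vec)
  then have "vec_norm ((of_real t \<cdot>\<^sub>m A) *\<^sub>v v) = t * vec_norm (A *\<^sub>v v)"
    using t by (simp add: vec_norm_eq sq_norm_scale real_sqrt_mult)
  also have "\<dots> \<le> t * op_norm A"
    using v t by (intro mult_left_mono vec_norm_mult_mat_vec_le_op_norm) auto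
  finally show "vec_norm ((of_real t \<cdot>\<^sub>m A) *\<^sub>v v) \<le> t * op_norm A" .
qed

lemma op_norm_smult:
  assumes t: "t > 0"
  shows "op_norm (of_real t \<cdot>\<^sub>m A) = t * op_norm A"
proof (rule antisym)
  show "op_norm (of_real t \<cdot>\<^sub>m A) \<le> t * op_norm A" using t by (intro op_norm_smult_le) auto
  have "of_real (inverse t) \<cdot>\<^sub>m (of_real t \<cdot>\<^sub>m A) = A"
    using t by (intro eq_matI) auto
  then have "op_norm A \<le> inverse t * op_norm (of_real t \<cdot>\<^sub>m A)"
    using op_norm_smult_le[of "inverse t" "of_real t \<cdot>\<^sub>m A"] t by simp
  then show "t * op_norm A \<le> op_norm (of_real t \<cdot>\<^sub>m A)" using t by (simp add: field_simps)
qed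

lemma tuple_norm_smult: "t > 0 \<Longrightarrow> tuple_norm (\<lambda>j. of_real t \<cdot>\<^sub>m X j) = t * tuple_norm X"
  by (simp add: tuple_norm_def op_norm_smult sum_distrib_left)

lemma tuple_norm_nonneg: "0 \<le> tuple_norm X"
  by (simp add: tuple_norm_def sum_nonneg op_norm_nonneg)

lemma tuple_norm_uminus: "tuple_norm (\<lambda>j. - X j) = tuple_norm X"
  by (simp add: tuple_norm_def op_norm_uminus)

lemma pencil_smult:
  assumes "Q \<in> mat_tuples n" "Y \<in> mat_tuples m"
  shows "pencil n m Q (\<lambda>j. of_real t \<cdot>\<^sub>m Y j) = of_real t \<cdot>\<^sub>m pencil n m Q Y"
proof (rule eq_matI)
  fix i k assume "i < dim_row (complex_of_real t \<cdot>\<^sub>m pencil n m Q Y)" "k < dim_col (complex_of_real t \<cdot>\<^sub>m pencil n m Q Y)"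
  then have ik: "i < n * m" "k < n * m" by (auto simp: pencil_def)
  then have m: "m > 0" by (cases m) auto
  have c: "Q j \<in> carrier_mat n n" "Y j \<in> carrier_mat m m" for j using assms by (auto simp: mat_tuples_def)
  have "kronecker (Q j) (of_real t \<cdot>\<^sub>m Y j) $$ (i, k) = of_real t * kronecker (Q j) (Y j) $$ (i, k)" for j
    using c[of j] ik m by (auto simp: kronecker_def)
  then show "pencil n m Q (\<lambda>j. of_real t \<cdot>\<^sub>m Y j) $$ (i, k) = (of_real t \<cdot>\<^sub>m pencil n m Q Y) $$ (i, k)"
    using ik by (simp add: pencil_def sum_distrib_left)
qed (auto simp: pencil_def)

locale balanced_family =
  fixes \<C> :: "nat \<Rightarrow> ('g::finite \<Rightarrow> complex mat) set" and \<epsilon> :: real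
  assumes subset: "k \<ge> 1 \<Longrightarrow> \<C> k \<subseteq> mat_tuples k"
    and balanced: "matrix_balanced \<C>"
    and sums: "closed_direct_sums \<C>"
    and eps: "\<epsilon> > 0" and nbhd: "k \<ge> 1 \<Longrightarrow> free_nbhd \<epsilon> k \<subseteq> \<C> k"
begin

lemma sandwich_mem:
  assumes "m \<ge> 1" "n \<ge> 1" "Y \<in> \<C> m" "contraction m n c1" "contraction m n c2"
  shows "tuple_of n (sandwich m c2 Y c1) \<in> \<C> n"
proof -
  have Y: "Y \<in> mat_tuples m" using assms subset by auto
  show ?thesis
    unfolding tuple_of_sandwich[OF Y]
    using balanced assms op_norm_contraction[OF assms(4)] op_norm_contraction[OF assms(5)]
    unfolding matrix_balanced_def by (metis mat_carrier)
qed

lemma direct_sum_mem: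
  assumes "m \<ge> 1" "n \<ge> 1" "X \<in> \<C> n" "Y \<in> \<C> m"
  shows "direct_sum n X m Y \<in> \<C> (n + m)"
  using sums assms unfolding closed_direct_sums_def direct_sum_def[abs_def] by blast

lemma small_mem:
  assumes "m \<ge> 1" "X \<in> mat_tuples m" "tuple_norm X < \<epsilon>"
  shows "X \<in> \<C> m"
  using nbhd[OF assms(1)] assms by (auto simp: free_nbhd_def)

lemma zero_mem: "m \<ge> 1 \<Longrightarrow> (\<lambda>j. 0\<^sub>m m m) \<in> \<C> m"
proof -
  assume m: "m \<ge> 1"
  have "op_norm (0\<^sub>m m m) \<le> 0"
    by (rule op_norm_le) (auto simp: vec_norm_def L2_set_def)
  then have "tuple_norm (\<lambda>j::'g. 0\<^sub>m m m) = 0" using op_norm_nonneg[of "0\<^sub>m m m"] by (simp add: tuple_norm_def)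
  then show ?thesis using m eps by (intro small_mem) (auto simp: mat_tuples_def)
qed

lemma absorbing:
  assumes m: "m \<ge> 1" and X: "X \<in> mat_tuples m"
  obtains t where "t > 0" "(\<lambda>j. of_real t \<cdot>\<^sub>m X j) \<in> \<C> m"
proof
  define t where "t = \<epsilon> / (1 + tuple_norm X)"
  have 1: "0 < 1 + tuple_norm X" using tuple_norm_nonneg[of X] by simp
  show t: "t > 0" using 1 eps by (simp add: t_def)
  have "t * tuple_norm X < \<epsilon>" using 1 eps by (simp add: t_def field_simps)
  then show "(\<lambda>j. of_real t \<cdot>\<^sub>m X j) \<in> \<C> m"
    using X m t by (intro small_mem) (auto simp: tuple_norm_smult mat_tuples_def)
qed

lemma convex_mem:
  assumes n: "n \<ge> 1" and X: "X \<in> \<C> n" and Y: "Y \<in> \<C> n" and t: "0 < t" "t < 1"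
  shows "(\<lambda>j. of_real t \<cdot>\<^sub>m X j + of_real (1 - t) \<cdot>\<^sub>m Y j) \<in> \<C> n"
proof -
  have car: "X \<in> mat_tuples n" "Y \<in> mat_tuples n" using X Y subset n by auto
  define e :: "nat \<Rightarrow> nat \<Rightarrow> complex" where "e = (\<lambda>b k. if b = k then 1 else 0)"
  \<comment> \<open>The identity scaled by sqrt t on top of the identity scaled by sqrt (1-t) is an
    isometry; compressing the direct sum by it gives the convex combination.\<close>
  define c where "c = stack n (\<lambda>b k. of_real (sqrt t) * e b k) (\<lambda>b k. of_real (sqrt (1 - t)) * e b k)"
  have apply_mat_e: "sq_norm n (apply_mat n e v) = sq_norm n v" for v
    unfolding sq_norm_def apply_mat_def e_def by (intro sum.cong refl) (simp add: if_distrib[of "\<lambda>x. x * _"] cong: if_cong)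
  have "sq_norm (n + n) (apply_mat n c v) = t * sq_norm n v + (1 - t) * sq_norm n v" for v
    unfolding c_def sq_norm_stack apply_mat_scale sq_norm_scale apply_mat_e using t by (simp add: norm_of_real)
  then have "contraction (n + n) n c" by (simp add: contraction_def algebra_simps)
  then have "tuple_of n (sandwich (n + n) c (direct_sum n X n Y) c) \<in> \<C> n"
    using n X Y by (intro sandwich_mem direct_sum_mem) auto
  moreover have entry: "sandwich (n + n) c (direct_sum n X n Y) c j k l =
      of_real t * X j $$ (k, l) + of_real (1 - t) * Y j $$ (k, l)" if "k < n" "l < n" for j k l
    unfolding c_def sandwich_direct_sum[OF car] sandwich_scale using that t
    by (simp add: e_def sandwich_identity del: of_real_mult of_real_diff)
  have "tuple_of n (sandwich (n + n) c (direct_sum n X n Y) c) =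
      (\<lambda>j. of_real t \<cdot>\<^sub>m X j + of_real (1 - t) \<cdot>\<^sub>m Y j)"
  proof
    fix j
    have "X j \<in> carrier_mat n n" "Y j \<in> carrier_mat n n" using car by (auto simp: mat_tuples_def)
    then show "tuple_of n (sandwich (n + n) c (direct_sum n X n Y) c) j = of_real t \<cdot>\<^sub>m X j + of_real (1 - t) \<cdot>\<^sub>m Y j"
      by (intro eq_matI) (auto simp: tuple_of_def entry)
  qed
  ultimately show ?thesis by simp
qed

text \<open>The perturbation is (1-t) times a tuple of norm below \<epsilon>, which the free
  neighborhood contains. This is the quantitative room behind the statements on closure and interior
  below.\<close>

lemma convex_small_mem:
  assumes n: "n \<ge> 1" and X: "X \<in> \<C> n" and Y: "Y \<in> mat_tuples n" "tuple_norm Y < \<epsilon> * (1 - t)" and t: "0 < t" "t < 1"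
  shows "(\<lambda>j. of_real t \<cdot>\<^sub>m X j + Y j) \<in> \<C> n"
proof -
  have "(\<lambda>j. of_real (1 / (1 - t)) \<cdot>\<^sub>m Y j) \<in> \<C> n"
    using Y t n by (intro small_mem) (auto simp: mat_tuples_def tuple_norm_smult divide_simps simp del: of_real_divide)
  note mem = convex_mem[OF n X this t]
  have "of_real (1 - t) \<cdot>\<^sub>m (of_real (1 / (1 - t)) \<cdot>\<^sub>m Y j) = Y j" for j
  proof -
    have "complex_of_real (1 - t) * of_real (1 / (1 - t)) = 1"
      using t by (simp flip: of_real_mult)
    then have "complex_of_real (1 - t) * (of_real (1 / (1 - t)) * z) = z" for z
      by (metis mult.assoc mult_1)
    then show ?thesis by (intro eq_matI) (simp_all del: of_real_diff of_real_divide)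
  qed
  with mem show ?thesis by (simp only:)
qed

section \<open>Interior and closure in terms of dilations\<close>

lemma interior_expand:
  assumes m: "m \<ge> 1" and Y: "Y \<in> tuple_topology m interior_of \<C> m"
  obtains s where "s > 1" "(\<lambda>j. of_real s \<cdot>\<^sub>m Y j) \<in> \<C> m" "Y \<in> \<C> m"
proof -
  interpret Metric_space "mat_tuples m" "tuple_dist m :: ('g \<Rightarrow> complex mat) \<Rightarrow> _"
    by (rule Metric_space_mat_tuples)
  obtain r where r: "r > 0" "mball Y r \<subseteq> \<C> m" and Ym: "Y \<in> mat_tuples m"
    using Y unfolding tuple_topology_def metric_interior_of by auto
  \<comment> \<open>The tuple (1+s)Y is at distance s times the norm of Y, which is below r; adding
    1 in the denominator covers Y = 0.\<close>
  define s where "s = r / (1 + tuple_norm Y)"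
  have 1: "0 < 1 + tuple_norm Y" using tuple_norm_nonneg[of Y] by simp
  have s: "s > 0" using 1 r by (simp add: s_def)
  have sY: "(\<lambda>j. of_real (1 + s) \<cdot>\<^sub>m Y j) \<in> mat_tuples m" using Ym by (auto simp: mat_tuples_def)
  have "Y j - of_real (1 + s) \<cdot>\<^sub>m Y j = - (of_real s \<cdot>\<^sub>m Y j)" for j
    by (intro eq_matI) (auto simp: algebra_simps)
  then have "tuple_dist m Y (\<lambda>j. of_real (1 + s) \<cdot>\<^sub>m Y j) = s * tuple_norm Y"
    unfolding tuple_dist_eq[OF Ym sY] using s by (simp add: tuple_norm_uminus tuple_norm_smult)
  also have "\<dots> < r" using 1 r by (simp add: s_def field_simps)
  finally have "(\<lambda>j. of_real (1 + s) \<cdot>\<^sub>m Y j) \<in> mball Y r" using Ym sY by (simp add: in_mball)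
  then have "(\<lambda>j. of_real (1 + s) \<cdot>\<^sub>m Y j) \<in> \<C> m" using r by (rule_tac subsetD)
  moreover have "Y \<in> \<C> m" using r Ym by (auto simp: subset_iff)
  ultimately show thesis using s by (intro that[of "1 + s"]) auto
qed

text \<open>With Z in the family close to X, write t X = t Z + t (X - Z); the radius
  \<epsilon>(1-t)/t makes the second term small enough for \<open>convex_small_mem\<close>.\<close>

lemma closure_shrink:
  assumes n: "n \<ge> 1" and X: "X \<in> tuple_topology n closure_of \<C> n" and t: "0 < t" "t < 1"
  shows "X \<in> mat_tuples n" "(\<lambda>j. of_real t \<cdot>\<^sub>m X j) \<in> \<C> n"
proof -
  interpret Metric_space "mat_tuples n" "tuple_dist n :: ('g \<Rightarrow> complex mat) \<Rightarrow> _"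
    by (rule Metric_space_mat_tuples)
  show Xm: "X \<in> mat_tuples n"
    using X unfolding tuple_topology_def metric_closure_of by auto
  have "\<epsilon> * (1 - t) / t > 0" using eps t by simp
  then obtain Z where Z: "Z \<in> \<C> n" "Z \<in> mball X (\<epsilon> * (1 - t) / t)"
    using X unfolding tuple_topology_def metric_closure_of by blast
  then have Zm: "Z \<in> mat_tuples n" and d: "tuple_norm (\<lambda>j. X j - Z j) < \<epsilon> * (1 - t) / t"
    using Xm by (auto simp: in_mball tuple_dist_eq)
  have c: "X j \<in> carrier_mat n n" "Z j \<in> carrier_mat n n" for j
    using Xm Zm by (auto simp: mat_tuples_def)
  have "(\<lambda>j. of_real t \<cdot>\<^sub>m Z j + of_real t \<cdot>\<^sub>m (X j - Z j)) \<in> \<C> n"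
    using c d t by (intro convex_small_mem n Z(1)) (auto simp: mat_tuples_def tuple_norm_smult field_simps intro!: smult_carrier_mat minus_carrier_mat)
  moreover have "of_real t \<cdot>\<^sub>m Z j + of_real t \<cdot>\<^sub>m (X j - Z j) = of_real t \<cdot>\<^sub>m X j" for j
    using c[of j] by (intro eq_matI) (auto simp: algebra_simps)
  ultimately show "(\<lambda>j. of_real t \<cdot>\<^sub>m X j) \<in> \<C> n" by simp
qed

text \<open>Every Y near X is (1/s)(s X) + (Y - X), so the slack 1 - 1/s gives a whole ball.\<close>

lemma interior_if_expandable:
  assumes n: "n \<ge> 1" and X: "X \<in> mat_tuples n" and s: "s > 1" "(\<lambda>j. of_real s \<cdot>\<^sub>m X j) \<in> \<C> n"
  shows "X \<in> tuple_topology n interior_of \<C> n"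
proof -
  interpret Metric_space "mat_tuples n" "tuple_dist n :: ('g \<Rightarrow> complex mat) \<Rightarrow> _"
    by (rule Metric_space_mat_tuples)
  have "mball X (\<epsilon> * (1 - 1 / s)) \<subseteq> \<C> n"
  proof
    fix Y assume "Y \<in> mball X (\<epsilon> * (1 - 1 / s))"
    then have Y: "Y \<in> mat_tuples n" and d: "tuple_norm (\<lambda>j. Y j - X j) < \<epsilon> * (1 - 1 / s)"
      using X commute[of X Y] by (auto simp: in_mball tuple_dist_eq)
    have c: "X j \<in> carrier_mat n n" "Y j \<in> carrier_mat n n" for j
      using X Y by (auto simp: mat_tuples_def)
    have "(\<lambda>j. of_real (1 / s) \<cdot>\<^sub>m (of_real s \<cdot>\<^sub>m X j) + (Y j - X j)) \<in> \<C> n"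
      using c d s by (intro convex_small_mem n) (auto simp: mat_tuples_def intro!: minus_carrier_mat)
    moreover have "of_real (1 / s) \<cdot>\<^sub>m (of_real s \<cdot>\<^sub>m X j) + (Y j - X j) = Y j" for j
      using c[of j] s by (intro eq_matI) auto
    ultimately show "Y \<in> \<C> n" by (simp only:)
  qed
  moreover have "\<epsilon> * (1 - 1 / s) > 0" using eps s by simp
  ultimately show ?thesis using X unfolding tuple_topology_def metric_interior_of by blast
qed

end

section \<open>The separating functional and its dominating forms\<close>

definition entries :: "('g \<Rightarrow> complex mat) \<Rightarrow> 'g \<Rightarrow> nat \<Rightarrow> nat \<Rightarrow> complex" where
  "entries X j k l = X j $$ (k, l)"

text \<open>A general real-linear functional on n x n tuples. Its argument is a family of entries,
  so that \<open>sandwich\<close> can be inserted and linearity holds without dimension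
  conditions.\<close>

definition re_pairing :: "('g::finite \<times> nat \<times> nat \<Rightarrow> complex) \<Rightarrow> nat \<Rightarrow> ('g \<Rightarrow> nat \<Rightarrow> nat \<Rightarrow> complex) \<Rightarrow> real" where
  "re_pairing c n F = Re (\<Sum>j\<in>UNIV. \<Sum>k<n. \<Sum>l<n. c (j, k, l) * F j k l)"

lemma re_pairing_cong:
  "(\<And>j k l. k < n \<Longrightarrow> l < n \<Longrightarrow> F j k l = G j k l) \<Longrightarrow> re_pairing c n F = re_pairing c n G"
  by (simp add: re_pairing_def)

lemma re_pairing_add:
  "re_pairing c n (\<lambda>j k l. F j k l + G j k l) = re_pairing c n F + re_pairing c n G"
  by (simp add: re_pairing_def distrib_left sum.distrib)

lemma re_pairing_scale:
  "re_pairing c n (\<lambda>j k l. of_real t * F j k l) = t * re_pairing c n F"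
proof -
  have "(\<Sum>j\<in>UNIV. \<Sum>k<n. \<Sum>l<n. c (j, k, l) * (of_real t * F j k l)) =
      of_real t * (\<Sum>j\<in>UNIV. \<Sum>k<n. \<Sum>l<n. c (j, k, l) * F j k l)"
    by (simp add: sum_distrib_left mult.left_commute)
  then show ?thesis by (simp add: re_pairing_def del: Re_sum)
qed

lemma re_pairing_zero: "re_pairing c n (\<lambda>j k l. 0) = 0"
  by (simp add: re_pairing_def)

lemma re_pairing_tuple_of: "re_pairing c n (entries (tuple_of n F)) = re_pairing c n F"
  by (rule re_pairing_cong) (simp add: entries_def tuple_of_def)

lemma sum_triples:
  fixes f :: "'a \<times> nat \<times> nat \<Rightarrow> complex"
  shows "(\<Sum>i\<in>A \<times> {..<n} \<times> {..<n}. f i) = (\<Sum>j\<in>A. \<Sum>k<n. \<Sum>l<n. f (j, k, l))"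
  by (simp add: sum.cartesian_product')

lemma sesq_mat_add: "sesq n (\<lambda>k l. S k l + T k l) x y = sesq n S x y + sesq n T x y"
  by (simp add: sesq_def distrib_right sum.distrib)

lemma sesq_mat_scale: "sesq n (\<lambda>k l. c * T k l) x y = c * sesq n T x y"
  by (simp add: sesq_def sum_distrib_left mult.assoc)

lemma sesq_mat_cong: "(\<And>k l. k < n \<Longrightarrow> l < n \<Longrightarrow> S k l = T k l) \<Longrightarrow> sesq n S x y = sesq n T x y"
  by (simp add: sesq_def)

lemma sesq_identity: "sesq n (\<lambda>k l. if k = l then 1 else 0) v v = of_real (sq_norm n v)"
proof -
  have "sesq n (\<lambda>k l. if k = l then 1 else 0) v v = (\<Sum>k<n. \<Sum>l<n. if k = l then cnj (v k) * v k else 0)"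
    unfolding sesq_def by (intro sum.cong refl) auto
  also have "\<dots> = of_real (sq_norm n v)"
    by (simp add: sq_norm_def complex_norm_square mult.commute del: of_real_power)
  finally show ?thesis .
qed

lemma sesq_gram: "sesq n (\<lambda>k l. \<Sum>b<m. cnj (c b k) * c b l) v v = of_real (sq_norm m (apply_mat n c v))"
proof -
  have "sesq n (\<lambda>k l. \<Sum>b<m. cnj (c b k) * c b l) v v =
      (\<Sum>k<n. \<Sum>l<n. \<Sum>b<m. cnj (c b k * v k) * (c b l * v l))"
    by (simp add: sesq_def sum_distrib_right sum_distrib_left mult_ac)
  also have "\<dots> = (\<Sum>b<m. \<Sum>k<n. \<Sum>l<n. cnj (c b k * v k) * (c b l * v l))"
    by (subst sum.swap, subst (2) sum.swap) (rule refl)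
  also have "\<dots> = (\<Sum>b<m. cnj (apply_mat n c v b) * apply_mat n c v b)"
    by (simp add: apply_mat_def sum_product)
  also have "\<dots> = of_real (sq_norm m (apply_mat n c v))"
    by (simp add: sq_norm_def complex_norm_square mult.commute del: of_real_power)
  finally show ?thesis .
qed

text \<open>A crude bound; it serves only to show that the set separated in
  \<open>dominating_forms\<close> is absorbing.\<close>

lemma sesq_bound: "Re (sesq n M v v) \<le> (\<Sum>k<n. \<Sum>l<n. cmod (M k l)) * sq_norm n v"
proof -
  have "Re (M k l * cnj (v k) * v l) \<le> cmod (M k l) * sq_norm n v" if kl: "k < n" "l < n" for k l
  proof -
    have S: "(cmod (v i))\<^sup>2 \<le> sq_norm n v" if "i < n" for i
      unfolding sq_norm_def using that by (intro member_le_sum) auto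
    have "(cmod (v k))\<^sup>2 + (cmod (v l))\<^sup>2 \<le> 2 * sq_norm n v" using S[OF kl(1)] S[OF kl(2)] by simp
    moreover have "2 * (cmod (v k) * cmod (v l)) \<le> (cmod (v k))\<^sup>2 + (cmod (v l))\<^sup>2"
      using sum_squares_bound[of "cmod (v k)" "cmod (v l)"] by simp
    ultimately have "cmod (v k) * cmod (v l) \<le> sq_norm n v" by linarith
    then have "cmod (M k l * cnj (v k) * v l) \<le> cmod (M k l) * sq_norm n v"
      by (simp add: norm_mult mult.assoc mult_left_mono)
    then show ?thesis using complex_Re_le_cmod order_trans by blast
  qed
  then have "Re (sesq n M v v) \<le> (\<Sum>k<n. \<Sum>l<n. cmod (M k l) * sq_norm n v)"
    unfolding sesq_def Re_sum by (intro sum_mono) auto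
  then show ?thesis by (simp add: sum_distrib_right)
qed

context balanced_family
begin

lemma separate_boundary:
  assumes n: "n \<ge> 1" and X: "X \<in> tuple_topology n frontier_of \<C> n"
  obtains c where "\<And>Y. Y \<in> \<C> n \<Longrightarrow> re_pairing c n (entries Y) \<le> 1"
    and "re_pairing c n (entries X) \<ge> 1"
proof -
  define I :: "('g \<times> nat \<times> nat) set" where "I = UNIV \<times> {..<n} \<times> {..<n}"
  define dec :: "('g \<times> nat \<times> nat \<Rightarrow> complex) \<Rightarrow> 'g \<Rightarrow> complex mat" where
    "dec x = tuple_of n (\<lambda>j k l. x (j, k, l))" for x
  define enc :: "('g \<Rightarrow> complex mat) \<Rightarrow> 'g \<times> nat \<times> nat \<Rightarrow> complex" where
    "enc Y = (\<lambda>(j, k, l). if k < n \<and> l < n then Y j $$ (k, l) else 0)" for Y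
  define D where "D = {x. dec x \<in> \<C> n}"
  have Xm: "X \<in> mat_tuples n" and Xi: "X \<notin> tuple_topology n interior_of \<C> n"
    using X closure_shrink(1)[OF n, of X "1/2"] by (auto simp: frontier_of_def)
  have enc_dec: "dec (enc Y) = Y" if "Y \<in> mat_tuples n" for Y
  proof
    fix j
    have "Y j \<in> carrier_mat n n" using that by (auto simp: mat_tuples_def)
    then show "dec (enc Y) j = Y j" by (intro eq_matI) (auto simp: dec_def enc_def tuple_of_def)
  qed
  have enc_supp: "enc Y \<in> supported_on I" for Y by (auto simp: supported_on_def I_def enc_def)
  have dec_scale: "dec (\<lambda>i. of_real t * x i) = (\<lambda>j. of_real t \<cdot>\<^sub>m dec x j)" for t x
    by (intro ext eq_matI) (auto simp: dec_def tuple_of_def)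
  have dec_mem: "dec x \<in> mat_tuples n" for x by (simp add: mat_tuples_def dec_def tuple_of_def)
  have pair: "Re (\<Sum>i\<in>I. c i * enc Y i) = re_pairing c n (entries Y)" for c Y
    unfolding I_def sum_triples re_pairing_def by (simp add: enc_def entries_def)
  have fin: "finite I" by (simp add: I_def)
  obtain c where c: "\<And>x. x \<in> D \<Longrightarrow> x \<in> supported_on I \<Longrightarrow> Re (\<Sum>i\<in>I. c i * x i) \<le> 1"
    "Re (\<Sum>i\<in>I. c i * enc X i) \<ge> 1"
  proof (rule separation_coordinates[OF fin enc_supp[of X], of D])
    fix x y :: "'g \<times> nat \<times> nat \<Rightarrow> complex" and t :: real
    assume D: "x \<in> D" "y \<in> D" and t: "0 < t" "t < 1"
    have "dec (\<lambda>i. of_real t * x i + of_real (1 - t) * y i) =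
        (\<lambda>j. of_real t \<cdot>\<^sub>m dec x j + of_real (1 - t) \<cdot>\<^sub>m dec y j)"
      by (intro ext eq_matI) (auto simp: dec_def tuple_of_def)
    then show "(\<lambda>i. of_real t * x i + of_real (1 - t) * y i) \<in> D"
      using convex_mem[OF n _ _ t, of "dec x" "dec y"] D by (simp add: D_def)
  next
    fix x :: "'g \<times> nat \<times> nat \<Rightarrow> complex" assume "x \<in> supported_on I"
    show "\<exists>t>0. (\<lambda>i. of_real t * x i) \<in> D"
      using absorbing[OF n dec_mem[of x]] by (auto simp: D_def dec_scale)
  next
    fix t :: real assume t: "t > 1"
    show "(\<lambda>i. of_real t * enc X i) \<notin> D"
      using interior_if_expandable[OF n Xm t] Xi by (auto simp: D_def dec_scale enc_dec[OF Xm])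
  next
    fix c assume "\<And>x. x \<in> D \<Longrightarrow> x \<in> supported_on I \<Longrightarrow> Re (\<Sum>i\<in>I. c i * x i) \<le> 1"
      "Re (\<Sum>i\<in>I. c i * enc X i) \<ge> 1"
    then show ?thesis by (rule that)
  qed
  show thesis
  proof
    fix Y assume Y: "Y \<in> \<C> n"
    then have "enc Y \<in> D" using subset[OF n] enc_dec[of Y] by (auto simp: D_def)
    then show "re_pairing c n (entries Y) \<le> 1" using c(1) enc_supp by (simp add: pair[symmetric])
  qed (use c(2) pair in simp)
qed

text \<open>Dividing both matrices by sqrt r makes them contractions and divides the value by
  r.\<close>

lemma re_pairing_sandwich_le:
  assumes n: "n \<ge> 1" and le: "\<And>Y. Y \<in> \<C> n \<Longrightarrow> re_pairing c n (entries Y) \<le> 1"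
    and m: "m \<ge> 1" and Y: "Y \<in> \<C> m" and r: "r > 0"
    and c1: "\<And>v. sq_norm m (apply_mat n c1 v) \<le> r * sq_norm n v"
    and c2: "\<And>v. sq_norm m (apply_mat n c2 v) \<le> r * sq_norm n v"
  shows "re_pairing c n (sandwich m c2 Y c1) \<le> r"
proof -
  define s where "s = 1 / sqrt r"
  have ss: "s\<^sup>2 = 1 / r" "s * s = 1 / r" using r by (auto simp: s_def power_divide)
  have "contraction m n (\<lambda>b k. of_real s * d b k)" if "\<And>v. sq_norm m (apply_mat n d v) \<le> r * sq_norm n v" for d
    unfolding contraction_def apply_mat_scale sq_norm_scale
    using that r by (simp add: norm_of_real ss field_simps)
  then have "tuple_of n (sandwich m (\<lambda>b k. of_real s * c2 b k) Y (\<lambda>b k. of_real s * c1 b k)) \<in> \<C> n"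
    using c1 c2 by (intro sandwich_mem n m Y) auto
  from le[OF this] have "s * s * re_pairing c n (sandwich m c2 Y c1) \<le> 1"
    unfolding re_pairing_tuple_of sandwich_scale[abs_def] re_pairing_scale .
  then show ?thesis using r by (simp add: ss(2) field_simps)
qed

text \<open>Pairs of n x n matrices, indexed by \<open>True\<close> for \<open>c1\<close> and
  \<open>False\<close> for \<open>c2\<close>, are separated from the pair of identities
  \<open>x0\<close>. Since \<open>x0\<close> itself lies in \<open>D\<close>, the separating
  functional equals 1 there, and the coefficients of the two components become the forms.\<close>

lemma dominating_forms:
  assumes n: "n \<ge> 1" and le: "\<And>Y. Y \<in> \<C> n \<Longrightarrow> re_pairing c n (entries Y) \<le> 1"
  obtains T1 T2 where "semi_inner_product n T1" "semi_inner_product n T2"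
    "(\<Sum>k<n. Re (T1 k k)) + (\<Sum>k<n. Re (T2 k k)) \<le> 2"
    "\<forall>m\<ge>1. \<forall>Y\<in>\<C> m. \<forall>c1 c2. re_pairing c n (sandwich m c2 Y c1) \<le>
      ((\<Sum>b<m. Re (sesq n T1 (c1 b) (c1 b))) + (\<Sum>b<m. Re (sesq n T2 (c2 b) (c2 b)))) / 2"
proof -
  define I :: "(bool \<times> nat \<times> nat) set" where "I = UNIV \<times> {..<n} \<times> {..<n}"
  \<comment> \<open>The scalar \<open>1 + re_pairing ...\<close> makes the identity pair a boundary point: if \<open>t > 1\<close>
    and \<open>t\<close> times it were in \<open>D\<close>, the functional would exceed the common bound on \<open>|c1|\<^sup>2\<close>, \<open>|c2|\<^sup>2\<close>.\<close>
  define dom where "dom x m Y c1 c2 \<longleftrightarrow> (\<forall>h v. Re (sesq n (\<lambda>k l. x (h, k, l)) v v) +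
      sq_norm m (apply_mat n (if h then c1 else c2) v) \<le> (1 + re_pairing c n (sandwich m c2 Y c1)) * sq_norm n v)"
    for x :: "bool \<times> nat \<times> nat \<Rightarrow> complex" and m Y c1 c2
  define D where "D = {x. \<exists>m\<ge>1. \<exists>Y\<in>\<C> m. \<exists>c1 c2. dom x m Y c1 c2}"
  define x0 :: "bool \<times> nat \<times> nat \<Rightarrow> complex" where
    "x0 = (\<lambda>(h, k, l). if k = l \<and> k < n then 1 else 0)"
  have x0_supp: "x0 \<in> supported_on I" by (auto simp: supported_on_def I_def x0_def)
  have x0_sesq: "sesq n (\<lambda>k l. x0 (h, k, l)) v v = of_real (sq_norm n v)" for h v
    unfolding sesq_identity[symmetric] by (rule sesq_mat_cong) (simp add: x0_def)
  have zero: "apply_mat n (\<lambda>b k. 0) v = (\<lambda>b. 0)" "sandwich m (\<lambda>b k. 0) Y d = (\<lambda>j k l. 0)"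
      "sandwich m d Y (\<lambda>b k. 0) = (\<lambda>j k l. 0)" for v m Y d
    by (auto simp: apply_mat_def sandwich_def fun_eq_iff)
  have dom_zero: "x \<in> D" if "\<And>h v. Re (sesq n (\<lambda>k l. x (h, k, l)) v v) \<le> sq_norm n v" for x
    unfolding D_def using that zero_mem[of 1]
    by (intro CollectI exI[of _ 1] conjI bexI[of _ "\<lambda>j. 0\<^sub>m 1 1"] exI[of _ "\<lambda>b k. 0"])
      (auto simp: dom_def zero re_pairing_zero sq_norm_def)
  obtain c' where c': "\<And>x. x \<in> D \<Longrightarrow> x \<in> supported_on I \<Longrightarrow> Re (\<Sum>i\<in>I. c' i * x i) \<le> 1"
    "Re (\<Sum>i\<in>I. c' i * x0 i) \<ge> 1"
  proof (rule separation_coordinates[of I x0 D])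
    fix x y :: "bool \<times> nat \<times> nat \<Rightarrow> complex" and t :: real
    assume D: "x \<in> D" "y \<in> D" and t: "0 < t" "t < 1"
    from D obtain m Y c1 c2 where x: "m \<ge> 1" "Y \<in> \<C> m" "dom x m Y c1 c2" by (auto simp: D_def)
    from D obtain m' Z d1 d2 where y: "m' \<ge> 1" "Z \<in> \<C> m'" "dom y m' Z d1 d2" by (auto simp: D_def)
    have Ym: "Y \<in> mat_tuples m" and Zm: "Z \<in> mat_tuples m'" using x y subset by auto
    \<comment> \<open>As in \<open>convex_mem\<close>, square-root weights make the squared lengths
      and the values of the functional combine with weights t and 1-t.\<close>
    define w where "w f g = stack m (\<lambda>b k. of_real (sqrt t) * f b k) (\<lambda>b k. of_real (sqrt (1 - t)) * g b k)"
      for f g :: "nat \<Rightarrow> nat \<Rightarrow> complex"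
    have sq: "sq_norm (m + m') (apply_mat n (w f g) v) = t * sq_norm m (apply_mat n f v) + (1 - t) * sq_norm m' (apply_mat n g v)" for f g v
      unfolding w_def sq_norm_stack apply_mat_scale sq_norm_scale using t by (simp add: norm_of_real)
    have sw: "re_pairing c n (sandwich (m + m') (w c2 d2) (direct_sum m Y m' Z) (w c1 d1)) =
        t * re_pairing c n (sandwich m c2 Y c1) + (1 - t) * re_pairing c n (sandwich m' d2 Z d1)"
      unfolding w_def sandwich_direct_sum[OF Ym Zm, abs_def] sandwich_scale re_pairing_add re_pairing_scale
      using t by simp
    have "dom (\<lambda>i. of_real t * x i + of_real (1 - t) * y i) (m + m') (direct_sum m Y m' Z) (w c1 d1) (w c2 d2)"
      unfolding dom_def
    proof (intro allI)
      fix h v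
      define a where "a = re_pairing c n (sandwich m c2 Y c1)"
      define b where "b = re_pairing c n (sandwich m' d2 Z d1)"
      have if_w: "(if h then w c1 d1 else w c2 d2) = w (if h then c1 else c2) (if h then d1 else d2)" by simp
      have X: "t * (Re (sesq n (\<lambda>k l. x (h, k, l)) v v) + sq_norm m (apply_mat n (if h then c1 else c2) v)) \<le>
          t * ((1 + a) * sq_norm n v)"
        using x(3) t unfolding dom_def a_def by (intro mult_left_mono) auto
      have Y: "(1 - t) * (Re (sesq n (\<lambda>k l. y (h, k, l)) v v) + sq_norm m' (apply_mat n (if h then d1 else d2) v)) \<le>
          (1 - t) * ((1 + b) * sq_norm n v)"
        using y(3) t unfolding dom_def b_def by (intro mult_left_mono) auto
      have R: "Re (complex_of_real r * z) = r * Re z" for r z by simp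
      show "Re (sesq n (\<lambda>k l. of_real t * x (h, k, l) + of_real (1 - t) * y (h, k, l)) v v) +
         sq_norm (m + m') (apply_mat n (if h then w c1 d1 else w c2 d2) v)
         \<le> (1 + re_pairing c n (sandwich (m + m') (w c2 d2) (direct_sum m Y m' Z) (w c1 d1))) * sq_norm n v"
        unfolding if_w sq sw sesq_mat_add sesq_mat_scale plus_complex.sel R a_def[symmetric] b_def[symmetric]
        using X Y by (simp add: algebra_simps)
    qed
    moreover have "direct_sum m Y m' Z \<in> \<C> (m + m')" using x y by (intro direct_sum_mem)
    ultimately show "(\<lambda>i. of_real t * x i + of_real (1 - t) * y i) \<in> D"
      unfolding D_def using x(1) by (intro CollectI exI[of _ "m + m'"]) auto
  next
    fix x :: "bool \<times> nat \<times> nat \<Rightarrow> complex" assume "x \<in> supported_on I"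
    define K where "K h = (\<Sum>k<n. \<Sum>l<n. cmod (x (h, k, l)))" for h
    have K: "0 \<le> K h" for h by (simp add: K_def sum_nonneg)
    define t where "t = 1 / (1 + K True + K False)"
    have t: "t > 0" "t * K h \<le> 1" for h
      using K[of True] K[of False] by (auto simp: t_def field_simps intro: add_pos_nonneg) (cases h; simp)
    have "(\<lambda>i. of_real t * x i) \<in> D"
    proof (rule dom_zero)
      fix h v
      have "Re (sesq n (\<lambda>k l. of_real t * x (h, k, l)) v v) = t * Re (sesq n (\<lambda>k l. x (h, k, l)) v v)"
        by (simp add: sesq_mat_scale)
      also have "\<dots> \<le> t * (K h * sq_norm n v)"
        unfolding K_def using t by (intro mult_left_mono sesq_bound) auto
      also have "\<dots> \<le> 1 * sq_norm n v"
        unfolding mult.assoc[symmetric] using t sq_norm_nonneg by (intro mult_right_mono) auto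
      finally show "Re (sesq n (\<lambda>k l. of_real t * x (h, k, l)) v v) \<le> sq_norm n v" by simp
    qed
    with t(1) show "\<exists>t>0. (\<lambda>i. of_real t * x i) \<in> D" by blast
  next
    fix t :: real assume t: "t > 1"
    show "(\<lambda>i. of_real t * x0 i) \<notin> D"
    proof
      assume "(\<lambda>i. of_real t * x0 i) \<in> D"
      then obtain m Y c1 c2 where Y: "m \<ge> 1" "Y \<in> \<C> m" and dom: "dom (\<lambda>i. of_real t * x0 i) m Y c1 c2"
        by (auto simp: D_def)
      define a where "a = re_pairing c n (sandwich m c2 Y c1)"
      have bound: "sq_norm m (apply_mat n (if h then c1 else c2) v) \<le> (1 + a - t) * sq_norm n v" for h v
        using dom[unfolded dom_def, rule_format, of h v]
        by (simp add: sesq_mat_scale x0_sesq a_def[symmetric] algebra_simps)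
      \<comment> \<open>A unit vector, available because n is positive: the nonnegative left side of
        \<open>bound\<close> forces 1 + a - t to be nonnegative.\<close>
      define v :: "nat \<Rightarrow> complex" where "v k = (if k = 0 then 1 else 0)" for k
      have "sq_norm n v = 1" using n by (simp add: sq_norm_def v_def if_distrib[of cmod] if_distrib[of "\<lambda>x. x\<^sup>2"] cong: if_cong)
      then have a: "t \<le> 1 + a" using bound[of True v] sq_norm_nonneg[of m "apply_mat n c1 v"] by simp
      \<comment> \<open>The midpoint of a - (t-1) and a. The bound 1 + a - t may be 0, whereas
        \<open>re_pairing_sandwich_le\<close> needs a positive constant; r is positive and still
        below a.\<close>
      define r where "r = a - (t - 1) / 2"
      have r: "r > 0" "1 + a - t \<le> r" "r < a" using a t by (auto simp: r_def field_simps)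
      have "sq_norm m (apply_mat n (if h then c1 else c2) v) \<le> r * sq_norm n v" for h v
        using bound[of h v] mult_right_mono[OF r(2) sq_norm_nonneg[of n v]] by linarith
      from this[of True] this[of False] have "a \<le> r"
        unfolding a_def by (intro re_pairing_sandwich_le[OF n le Y r(1)]) auto
      then show False using r by simp
    qed
  next
    fix c' assume "\<And>x. x \<in> D \<Longrightarrow> x \<in> supported_on I \<Longrightarrow> Re (\<Sum>i\<in>I. c' i * x i) \<le> 1"
      "Re (\<Sum>i\<in>I. c' i * x0 i) \<ge> 1"
    then show ?thesis by (rule that)
  qed (use x0_supp in \<open>auto simp: I_def\<close>)
  define f where "f x = Re (\<Sum>i\<in>I. c' i * x i)" for x
  have "x0 \<in> D" by (rule dom_zero) (simp add: x0_sesq)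
  then have f0: "f x0 = 1" using c' x0_supp by (force simp: f_def)
  \<comment> \<open>Adding the adjoint makes the form Hermitian and doubles the real part on the
    diagonal, which accounts for the factor 1/2 in the domination and for the trace 2.\<close>
  define T where "T h k l = c' (h, k, l) + cnj (c' (h, l, k))" for h k l
  have T_sesq: "Re (sesq n (T h) x x) = 2 * Re (\<Sum>k<n. \<Sum>l<n. c' (h, k, l) * cnj (x k) * x l)" for h x
  proof -
    have "sesq n (T h) x x = sesq n (\<lambda>k l. c' (h, k, l)) x x + sesq n (\<lambda>k l. cnj (c' (h, l, k))) x x"
      unfolding T_def by (rule sesq_mat_add)
    also have "sesq n (\<lambda>k l. cnj (c' (h, l, k))) x x = cnj (sesq n (\<lambda>k l. c' (h, k, l)) x x)"
      unfolding sesq_def cnj_sum by (subst sum.swap) (simp add: mult_ac)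
    finally have "Re (sesq n (T h) x x) = 2 * Re (sesq n (\<lambda>k l. c' (h, k, l)) x x)" by simp
    then show ?thesis by (simp only: sesq_def[of n "\<lambda>k l. c' (h, k, l)"])
  qed
  have main: "re_pairing c n (sandwich m c2 Y c1) \<le>
      ((\<Sum>b<m. Re (sesq n (T True) (c1 b) (c1 b))) + (\<Sum>b<m. Re (sesq n (T False) (c2 b) (c2 b)))) / 2"
    if m: "m \<ge> 1" and Y: "Y \<in> \<C> m" for m Y c1 c2
  proof -
    define a where "a = re_pairing c n (sandwich m c2 Y c1)"
    define d where "d h = (if h then c1 else c2)" for h
    define g :: "bool \<times> nat \<times> nat \<Rightarrow> complex" where
      "g = (\<lambda>(h, k, l). if k < n \<and> l < n then \<Sum>b<m. cnj (d h b k) * d h b l else 0)"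
    \<comment> \<open>This x satisfies the condition defining \<open>D\<close> with equality: it is
      (1+a) times the identities minus the Gram matrices. The bound f(x) <= 1 and f(x0) = 1 then
      leave a <= f(g).\<close>
    define x where "x i = of_real (1 + a) * x0 i + (-1) * g i" for i
    have supp: "x \<in> supported_on I"
      using x0_supp by (auto simp: supported_on_def I_def g_def x_def)
    have g_sesq: "sesq n (\<lambda>k l. g (h, k, l)) v v = of_real (sq_norm m (apply_mat n (d h) v))" for h v
      unfolding sesq_gram[symmetric] by (rule sesq_mat_cong) (simp add: g_def)
    have "Re (sesq n (\<lambda>k l. x (h, k, l)) v v) + sq_norm m (apply_mat n (d h) v) = (1 + a) * sq_norm n v" for h v
      unfolding x_def sesq_mat_add sesq_mat_scale g_sesq x0_sesq by simp
    then have "dom x m Y c1 c2" by (simp add: dom_def a_def[symmetric] d_def)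
    then have "f x \<le> 1" using c'(1)[OF _ supp] m Y by (auto simp: D_def f_def)
    moreover have "f x = (1 + a) * f x0 - f g"
      by (simp add: f_def x_def algebra_simps sum.distrib sum_distrib_left sum_subtractf)
    ultimately have "a \<le> f g" using f0 by simp
    also have "f g = (\<Sum>h\<in>UNIV. Re (\<Sum>k<n. \<Sum>l<n. \<Sum>b<m. c' (h, k, l) * cnj (d h b k) * d h b l))"
      unfolding f_def I_def sum_triples by (simp add: g_def sum_distrib_left mult.assoc)
    also have "\<dots> = (\<Sum>h\<in>UNIV. \<Sum>b<m. Re (\<Sum>k<n. \<Sum>l<n. c' (h, k, l) * cnj (d h b k) * d h b l))"
      unfolding Re_sum[symmetric]
      by (rule arg_cong[where f = Re], rule sum.cong[OF refl], subst sum.swap, subst (2) sum.swap, rule refl)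
    also have "\<dots> = (\<Sum>h\<in>UNIV. \<Sum>b<m. Re (sesq n (T h) (d h b) (d h b)) / 2)"
      by (simp add: T_sesq)
    finally show ?thesis
      by (simp add: a_def d_def UNIV_bool sum_divide_distrib add_divide_distrib)
  qed
  \<comment> \<open>Level 1, the zero tuple, one matrix zero and the other the single row x: the
    domination becomes 0 <= T(x,x)/2.\<close>
  have psd: "0 \<le> Re (sesq n (T h) x x)" for h x
  proof -
    have "Re (sesq n (T h') (\<lambda>l. 0) (\<lambda>l. 0)) = 0" for h' by (simp add: sesq_def)
    then show ?thesis
      using main[OF _ zero_mem[of 1], of "if h then (\<lambda>b k. 0) else (\<lambda>b. x)" "if h then (\<lambda>b. x) else (\<lambda>b k. 0)"]
      by (cases h) (auto simp: zero re_pairing_zero)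
  qed
  have semi: "semi_inner_product n (T h)" for h
    using psd by unfold_locales (auto simp: T_def)
  have "(\<Sum>h\<in>UNIV. \<Sum>k<n. Re (T h k k)) = 2 * f x0"
  proof -
    have "(\<Sum>i\<in>I. c' i * x0 i) = (\<Sum>h\<in>UNIV. \<Sum>k<n. \<Sum>l<n. if k = l then c' (h, k, k) else 0)"
      unfolding I_def sum_triples by (intro sum.cong refl) (auto simp: x0_def)
    then show ?thesis by (simp add: f_def T_def sum_distrib_left)
  qed
  then have "(\<Sum>k<n. Re (T True k k)) + (\<Sum>k<n. Re (T False k k)) \<le> 2" by (simp add: UNIV_bool f0)
  then show thesis using that semi main by blast
qed

end

section \<open>The separating pencil\<close>

lemma sum_lessThan_mult:
  fixes f :: "nat \<Rightarrow> 'a::comm_monoid_add"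
  shows "(\<Sum>i<n * m. f i) = (\<Sum>a<n. \<Sum>b<m. f (a * m + b))"
  by (induction n) (simp_all add: add.commute[of m] sum_lessThan_add)

lemma mult_add_less: "a * m + b < n * m" if "a < n" "b < m" for a b m n :: nat
proof -
  have "a * m + b < Suc a * m" using that by simp
  also have "\<dots> \<le> n * m" using that by (intro mult_le_mono1) simp
  finally show ?thesis .
qed

lemma pencil_index:
  assumes "Q \<in> mat_tuples n" "Y \<in> mat_tuples m" "a < n" "b < m" "a' < n" "b' < m"
  shows "pencil n m Q Y $$ (a * m + b, a' * m + b') = (\<Sum>j\<in>UNIV. Q j $$ (a, a') * Y j $$ (b, b'))"
proof -
  have d: "dim_row (Q j) = n" "dim_col (Q j) = n" "dim_row (Y j) = m" "dim_col (Y j) = m" for j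
    using assms by (auto simp: mat_tuples_def dest: spec[of _ j])
  have "kronecker (Q j) (Y j) $$ (a * m + b, a' * m + b') = Q j $$ (a, a') * Y j $$ (b, b')" for j
    using assms(3-) mult_add_less[of a n b m] mult_add_less[of a' n b' m]
    by (simp add: kronecker_def d)
  then show ?thesis using assms(3-) by (simp add: pencil_def mult_add_less)
qed

lemma pencil_form:
  fixes Q Y :: "'g::finite \<Rightarrow> complex mat"
  assumes Q: "Q \<in> mat_tuples n" and Y: "Y \<in> mat_tuples m" and v: "v \<in> carrier_vec (n * m)"
  shows "(\<Sum>i<n * m. cnj (w i) * (pencil n m Q Y *\<^sub>v v) $ i) =
    (\<Sum>a<n. \<Sum>b<m. \<Sum>a'<n. \<Sum>b'<m. \<Sum>j\<in>UNIV.
      cnj (w (a * m + b)) * (Q j $$ (a, a') * Y j $$ (b, b')) * v $ (a' * m + b'))"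
proof -
  have "(pencil n m Q Y *\<^sub>v v) $ (a * m + b) =
      (\<Sum>a'<n. \<Sum>b'<m. \<Sum>j\<in>UNIV. (Q j $$ (a, a') * Y j $$ (b, b')) * v $ (a' * m + b'))"
    if ab: "a < n" "b < m" for a b
  proof -
    have car: "pencil n m Q Y \<in> carrier_mat (n * m) (n * m)" by (simp add: pencil_def)
    show ?thesis
      unfolding mult_mat_vec_index[OF car v mult_add_less[OF ab]] sum_lessThan_mult
      using ab by (intro sum.cong refl) (simp add: pencil_index[OF Q Y] sum_distrib_right)
  qed
  then show ?thesis
    unfolding sum_lessThan_mult by (simp add: sum_distrib_left mult.assoc)
qed

text \<open>One bijection of index tuples in place of a chain of swaps.\<close>

lemma sum_rearrange:
  fixes f :: "'a \<Rightarrow> 'b \<Rightarrow> 'a \<Rightarrow> 'b \<Rightarrow> 'j \<Rightarrow> 'k \<Rightarrow> 'k \<Rightarrow> 'c::comm_monoid_add"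
  assumes fin: "finite A" "finite B" "finite J" "finite K"
  shows "(\<Sum>a\<in>A. \<Sum>b\<in>B. \<Sum>a'\<in>A. \<Sum>b'\<in>B. \<Sum>j\<in>J. \<Sum>k\<in>K. \<Sum>l\<in>K. f a b a' b' j k l) =
    (\<Sum>j\<in>J. \<Sum>k\<in>K. \<Sum>l\<in>K. \<Sum>b\<in>B. \<Sum>b'\<in>B. \<Sum>a'\<in>A. \<Sum>a\<in>A. f a b a' b' j k l)"
  unfolding sum.cartesian_product
  by (rule sum.reindex_bij_witness[where
        i = "\<lambda>(j, k, l, b, b', a', a). (a, b, a', b', j, k, l)" and
        j = "\<lambda>(a, b, a', b', j, k, l). (j, k, l, b, b', a', a)"]) auto

text \<open>The coefficient matrix of the functional in component j, read as a sesquilinear form and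
  evaluated on the Gram-Schmidt vectors \<open>u2 a\<close> and \<open>u1 a'\<close>.\<close>

definition coefficient :: "('g \<times> nat \<times> nat \<Rightarrow> complex) \<Rightarrow> nat \<Rightarrow> (nat \<Rightarrow> nat \<Rightarrow> complex) \<Rightarrow> (nat \<Rightarrow> nat \<Rightarrow> complex) \<Rightarrow>
    'g \<Rightarrow> complex mat" where
  "coefficient c n u1 u2 j = mat n n (\<lambda>(a, a'). \<Sum>k<n. \<Sum>l<n. c (j, k, l) * cnj (u2 a k) * u1 a' l)"

text \<open>A vector of length n m is read as an n x m array of coefficients, and its column b
  combines the Gram-Schmidt vectors into row b of an m x n matrix. The form of the pencil on two
  vectors is thereby the functional on a sandwich.\<close>

lemma pencil_coefficient_form:
  fixes Y :: "'g::finite \<Rightarrow> complex mat"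
  assumes Y: "Y \<in> mat_tuples m" and v: "v \<in> carrier_vec (n * m)"
  shows "Re (\<Sum>i<n * m. cnj (w i) * (pencil n m (coefficient c n u1 u2) Y *\<^sub>v v) $ i) =
    re_pairing c n (sandwich m (\<lambda>b k. \<Sum>a<n. w (a * m + b) * u2 a k) Y (\<lambda>b l. \<Sum>a<n. v $ (a * m + b) * u1 a l))"
proof -
  have Q: "coefficient c n u1 u2 \<in> mat_tuples n" by (simp add: mat_tuples_def coefficient_def)
  have "(\<Sum>i<n * m. cnj (w i) * (pencil n m (coefficient c n u1 u2) Y *\<^sub>v v) $ i) =
    (\<Sum>a<n. \<Sum>b<m. \<Sum>a'<n. \<Sum>b'<m. \<Sum>j\<in>UNIV. \<Sum>k<n. \<Sum>l<n.
      c (j, k, l) * (cnj (w (a * m + b) * u2 a k) * Y j $$ (b, b') * (v $ (a' * m + b') * u1 a' l)))"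
    unfolding pencil_form[OF Q Y v]
    by (intro sum.cong refl) (simp add: coefficient_def sum_distrib_left sum_distrib_right mult_ac)
  also have "\<dots> = (\<Sum>j\<in>UNIV. \<Sum>k<n. \<Sum>l<n. \<Sum>b<m. \<Sum>b'<m. \<Sum>a'<n. \<Sum>a<n.
      c (j, k, l) * (cnj (w (a * m + b) * u2 a k) * Y j $$ (b, b') * (v $ (a' * m + b') * u1 a' l)))"
    by (rule sum_rearrange) auto
  also have "\<dots> = (\<Sum>j\<in>UNIV. \<Sum>k<n. \<Sum>l<n. c (j, k, l) *
      sandwich m (\<lambda>b k. \<Sum>a<n. w (a * m + b) * u2 a k) Y (\<lambda>b l. \<Sum>a<n. v $ (a * m + b) * u1 a l) j k l)"
    by (intro sum.cong refl) (simp add: sandwich_def sum_distrib_left sum_distrib_right mult.assoc)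
  finally show ?thesis by (simp only: re_pairing_def)
qed

lemma vec_norm_smult:
  assumes "s \<ge> 0"
  shows "vec_norm (of_real s \<cdot>\<^sub>v x) = s * vec_norm x"
proof -
  have "sq_norm (dim_vec x) (\<lambda>i. (complex_of_real s \<cdot>\<^sub>v x) $ i) = sq_norm (dim_vec x) (\<lambda>i. of_real s * x $ i)"
    by (simp add: sq_norm_def)
  then show ?thesis using assms by (simp add: vec_norm_eq sq_norm_scale real_sqrt_mult)
qed

lemma vec_norm_mult_le: 
  assumes v: "v \<in> carrier_vec (dim_col A)"
  shows "vec_norm (A *\<^sub>v v) \<le> op_norm A * vec_norm v"
proof (cases "vec_norm v = 0")
  case True
  then have "v = 0\<^sub>v (dim_col A)"
    using v by (intro eq_vecI) (auto simp: vec_norm_def L2_set_eq_0_iff)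
  then have "A *\<^sub>v v = 0\<^sub>v (dim_row A)" by (intro eq_vecI) auto
  then show ?thesis using True by (simp add: vec_norm_def L2_set_def)
next
  case False
  define s where "s = 1 / vec_norm v"
  have pos: "vec_norm v > 0" using False by (simp add: vec_norm_eq sq_norm_nonneg less_le)
  have s: "s \<ge> 0" using pos by (simp add: s_def)
  have "A *\<^sub>v (of_real s \<cdot>\<^sub>v v) = of_real s \<cdot>\<^sub>v (A *\<^sub>v v)"
    using v by (intro mult_mat_vec) auto
  then have "s * vec_norm (A *\<^sub>v v) \<le> op_norm A"
    using vec_norm_mult_mat_vec_le_op_norm[of "of_real s \<cdot>\<^sub>v v" A] v pos
    by (simp add: vec_norm_smult[OF s]) (simp add: s_def)
  then show ?thesis using pos by (simp add: s_def field_simps)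
qed

lemma Re_sum_cnj_le:
  "Re (\<Sum>i<N. cnj (w i) * x i) \<le> sqrt (sq_norm N w) * sqrt (sq_norm N x)"
proof -
  have "Re (\<Sum>i<N. cnj (w i) * x i) \<le> cmod (\<Sum>i<N. cnj (w i) * x i)" by (rule complex_Re_le_cmod)
  also have "\<dots> \<le> (\<Sum>i<N. cmod (w i) * cmod (x i))"
    by (rule order_trans[OF norm_sum]) (simp add: norm_mult)
  also have "\<dots> \<le> sqrt (sq_norm N w) * sqrt (sq_norm N x)"
    using L2_set_mult_ineq[of "\<lambda>i. cmod (w i)" "\<lambda>i. cmod (x i)" "{..<N}"] by (simp add: L2_set_def sq_norm_def)
  finally show ?thesis .
qed

lemma bounded_multiples_eq_0:
  fixes p K :: real
  assumes "\<And>t. t * p \<le> K"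
  shows "p = 0"
proof (rule ccontr)
  assume "p \<noteq> 0"
  with assms[of "(K + 1) / p"] show False by simp
qed

lemma sandwich_diff_left:
  "sandwich m (\<lambda>b k. c b k - d b k) Y e = (\<lambda>j k l. sandwich m c Y e j k l + of_real (-1) * sandwich m d Y e j k l)"
  and sandwich_diff_right:
  "sandwich m e Y (\<lambda>b k. c b k - d b k) = (\<lambda>j k l. sandwich m e Y c j k l + of_real (-1) * sandwich m e Y d j k l)"
  by (auto simp: sandwich_def fun_eq_iff sum_subtractf algebra_simps)

context balanced_family
begin

text \<open>The upper bound uses that combinations of the Gram-Schmidt vectors are no longer than
  their coefficients; the lower bound uses Bessel's inequality at the standard basis and the trace
  bound.\<close>

lemma norming_pencil:
  assumes n: "n \<ge> 1" and X: "X \<in> tuple_topology n frontier_of \<C> n"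
  obtains Q where "Q \<in> mat_tuples n" "\<And>m Y. m \<ge> 1 \<Longrightarrow> Y \<in> \<C> m \<Longrightarrow> op_norm (pencil n m Q Y) \<le> 1"
    "op_norm (pencil n n Q X) \<ge> 1"
proof -
  obtain c where le: "\<And>Y. Y \<in> \<C> n \<Longrightarrow> re_pairing c n (entries Y) \<le> 1" and ge: "re_pairing c n (entries X) \<ge> 1"
    using separate_boundary[OF n X] by metis
  obtain T1 T2 where T1: "semi_inner_product n T1" and T2: "semi_inner_product n T2"
    and trace: "(\<Sum>k<n. Re (T1 k k)) + (\<Sum>k<n. Re (T2 k k)) \<le> 2"
    and dom: "\<forall>m\<ge>1. \<forall>Y\<in>\<C> m. \<forall>c1 c2. re_pairing c n (sandwich m c2 Y c1) \<le>
      ((\<Sum>b<m. Re (sesq n T1 (c1 b) (c1 b))) + (\<Sum>b<m. Re (sesq n T2 (c2 b) (c2 b)))) / 2"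
    using dominating_forms[OF n le] .
  note dom = dom[rule_format]
  interpret T1: semi_inner_product n T1 by (rule T1)
  interpret T2: semi_inner_product n T2 by (rule T2)
  define e :: "nat \<Rightarrow> nat \<Rightarrow> complex" where "e = (\<lambda>i l. if i = l then 1 else 0)"
  have sesq_e: "sesq n T (e b) (e b) = T b b" if "b < n" for T b
  proof -
    have "sesq n T (e b) (e b) = (\<Sum>k<n. if k = b then \<Sum>l<n. if l = b then T k l else 0 else 0)"
      unfolding sesq_def e_def by (intro sum.cong refl) (auto intro!: sum.cong simp del: sum.delta sum.delta')
    then show ?thesis using that by simp
  qed
  obtain u1 where u1: "\<forall>d. Re (sesq n T1 (\<lambda>l. \<Sum>a<n. d a * u1 a l) (\<lambda>l. \<Sum>a<n. d a * u1 a l)) \<le> (\<Sum>a<n. (cmod (d a))\<^sup>2)"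
    "\<forall>x. (\<Sum>a<n. (cmod (sesq n T1 (u1 a) x))\<^sup>2) \<le> Re (sesq n T1 x x)"
    "\<forall>i<n. sesq n T1 (\<lambda>l. e i l - (\<Sum>a<n. sesq n T1 (u1 a) (e i) * u1 a l))
      (\<lambda>l. e i l - (\<Sum>a<n. sesq n T1 (u1 a) (e i) * u1 a l)) = 0"
    using T1.gram_schmidt_factorization[of e] .
  note u1 = u1[rule_format]
  obtain u2 where u2: "\<forall>d. Re (sesq n T2 (\<lambda>l. \<Sum>a<n. d a * u2 a l) (\<lambda>l. \<Sum>a<n. d a * u2 a l)) \<le> (\<Sum>a<n. (cmod (d a))\<^sup>2)"
    "\<forall>x. (\<Sum>a<n. (cmod (sesq n T2 (u2 a) x))\<^sup>2) \<le> Re (sesq n T2 x x)"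
    "\<forall>i<n. sesq n T2 (\<lambda>l. e i l - (\<Sum>a<n. sesq n T2 (u2 a) (e i) * u2 a l))
      (\<lambda>l. e i l - (\<Sum>a<n. sesq n T2 (u2 a) (e i) * u2 a l)) = 0"
    using T2.gram_schmidt_factorization[of e] .
  note u2 = u2[rule_format]
  define Q where "Q = coefficient c n u1 u2"
  have Q: "Q \<in> mat_tuples n" by (simp add: Q_def mat_tuples_def coefficient_def)
  have blocks: "(\<Sum>b<m. \<Sum>a<n. (cmod (f (a * m + b)))\<^sup>2) = sq_norm (n * m) f" for f m
    unfolding sq_norm_def sum_lessThan_mult by (rule sum.swap)
  have upper: "op_norm (pencil n m Q Y) \<le> 1" if m: "m \<ge> 1" and Y: "Y \<in> \<C> m" for m Y
  proof (rule op_norm_le)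
    fix v assume "v \<in> carrier_vec (dim_col (pencil n m Q Y))" and v1: "vec_norm v \<le> 1"
    then have v: "v \<in> carrier_vec (n * m)" by (simp add: pencil_def)
    have Ym: "Y \<in> mat_tuples m" using Y subset m by auto
    \<comment> \<open>Pairing \<open>pencil * v\<close> with itself gives \<open>|x|\<^sup>2 \<le> (|v|\<^sup>2 + |x|\<^sup>2) / 2\<close>.\<close>
    define x where "x = pencil n m Q Y *\<^sub>v v"
    have dim: "dim_vec x = n * m" by (simp add: x_def pencil_def)
    have "sq_norm (n * m) (\<lambda>i. x $ i) = Re (\<Sum>i<n * m. cnj (x $ i) * x $ i)"
      unfolding sq_norm_def Re_sum
      by (intro sum.cong refl) (metis Re_complex_of_real complex_norm_square mult.commute)
    also have "\<dots> = re_pairing c n (sandwich m (\<lambda>b k. \<Sum>a<n. x $ (a * m + b) * u2 a k) Y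
        (\<lambda>b l. \<Sum>a<n. v $ (a * m + b) * u1 a l))"
      using pencil_coefficient_form[OF Ym v, of "\<lambda>i. x $ i" c u1 u2] by (simp only: x_def Q_def)
    also have "\<dots> \<le> ((\<Sum>b<m. \<Sum>a<n. (cmod (v $ (a * m + b)))\<^sup>2) + (\<Sum>b<m. \<Sum>a<n. (cmod (x $ (a * m + b)))\<^sup>2)) / 2"
      by (rule order_trans[OF dom[OF m Y]]) (intro divide_right_mono add_mono sum_mono u1 u2, simp)
    also have "\<dots> = (sq_norm (n * m) (\<lambda>i. v $ i) + sq_norm (n * m) (\<lambda>i. x $ i)) / 2"
      using blocks[of "\<lambda>i. v $ i" m] blocks[of "\<lambda>i. x $ i" m] by simp
    finally have "sq_norm (n * m) (\<lambda>i. x $ i) \<le> sq_norm (n * m) (\<lambda>i. v $ i)" by simp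
    then show "vec_norm (pencil n m Q Y *\<^sub>v v) \<le> 1"
      using v1 v dim by (simp add: vec_norm_le_1_iff x_def[symmetric])
  qed
  \<comment> \<open>\<open>X\<close> itself need not lie in \<open>\<C> n\<close>, but \<open>X / 2\<close> does, which suffices for the vanishing on null vectors.\<close>
  have half: "(\<lambda>j. of_real (1/2) \<cdot>\<^sub>m X j) \<in> \<C> n" and Xm: "X \<in> mat_tuples n"
    using closure_shrink[OF n, of X "1/2"] X by (auto simp: frontier_of_def)
  have sandwich_half: "sandwich n c2 (\<lambda>j. of_real (1/2) \<cdot>\<^sub>m X j) c1 = (\<lambda>j k l. of_real (1/2) * sandwich n c2 X c1 j k l)" for c1 c2
  proof (intro ext)
    fix j k l
    have "X j \<in> carrier_mat n n" using Xm by (auto simp: mat_tuples_def)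
    then show "sandwich n c2 (\<lambda>j. of_real (1/2) \<cdot>\<^sub>m X j) c1 j k l = of_real (1/2) * sandwich n c2 X c1 j k l"
      unfolding sandwich_def sum_distrib_left by (intro sum.cong refl) auto
  qed
  \<comment> \<open>Scaling \<open>c1\<close> leaves the right side of the domination unchanged
    while the functional grows linearly, so it must vanish. The factor 2 undoes the passage to X /
    2.\<close>
  have null1: "re_pairing c n (sandwich n c2 X c1) = 0" if null: "\<And>b. b < n \<Longrightarrow> sesq n T1 (c1 b) (c1 b) = 0" for c1 c2
  proof (rule bounded_multiples_eq_0)
    fix t :: real
    have s: "sandwich n c2 X (\<lambda>b l. of_real (2 * t) * c1 b l) = (\<lambda>j k l. of_real (2 * t) * sandwich n c2 X c1 j k l)"
      using sandwich_scale[of n 1 c2 X "2 * t" c1] by (intro ext) simp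
    have "re_pairing c n (sandwich n c2 (\<lambda>j. of_real (1/2) \<cdot>\<^sub>m X j) (\<lambda>b l. of_real (2 * t) * c1 b l)) \<le>
        ((\<Sum>b<n. 0) + (\<Sum>b<n. Re (sesq n T2 (c2 b) (c2 b)))) / 2"
      using dom[OF n half, of c2 "\<lambda>b l. of_real (2 * t) * c1 b l"] null
      by (simp add: T1.B_scale_left T1.B_scale_right)
    then show "t * re_pairing c n (sandwich n c2 X c1) \<le> (\<Sum>b<n. Re (sesq n T2 (c2 b) (c2 b))) / 2"
      unfolding sandwich_half s re_pairing_scale by simp
  qed
  have null2: "re_pairing c n (sandwich n c2 X c1) = 0" if null: "\<And>b. b < n \<Longrightarrow> sesq n T2 (c2 b) (c2 b) = 0" for c1 c2
  proof (rule bounded_multiples_eq_0)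
    fix t :: real
    have s: "sandwich n (\<lambda>b l. of_real (2 * t) * c2 b l) X c1 = (\<lambda>j k l. of_real (2 * t) * sandwich n c2 X c1 j k l)"
      using sandwich_scale[of n "2 * t" c2 X 1 c1] by (intro ext) simp
    have "re_pairing c n (sandwich n (\<lambda>b l. of_real (2 * t) * c2 b l) (\<lambda>j. of_real (1/2) \<cdot>\<^sub>m X j) c1) \<le>
        ((\<Sum>b<n. Re (sesq n T1 (c1 b) (c1 b))) + (\<Sum>b<n. 0)) / 2"
      using dom[OF n half, of "\<lambda>b l. of_real (2 * t) * c2 b l" c1] null
      by (simp add: T2.B_scale_left T2.B_scale_right)
    then show "t * re_pairing c n (sandwich n c2 X c1) \<le> (\<Sum>b<n. Re (sesq n T1 (c1 b) (c1 b))) / 2"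
      unfolding sandwich_half s re_pairing_scale by simp
  qed
  \<comment> \<open>The Gram-Schmidt coordinates of all standard basis vectors, with coordinate a of
    \<open>e b\<close> at position a n + b. The corresponding matrices \<open>c1\<close> and
    \<open>c2\<close> are the identity up to rows that are null for their forms.\<close>
  define v where "v = vec (n * n) (\<lambda>i. sesq n T1 (u1 (i div n)) (e (i mod n)))"
  define w where "w i = sesq n T2 (u2 (i div n)) (e (i mod n))" for i
  define c1 where "c1 b l = (\<Sum>a<n. sesq n T1 (u1 a) (e b) * u1 a l)" for b l
  define c2 where "c2 b l = (\<Sum>a<n. sesq n T2 (u2 a) (e b) * u2 a l)" for b l
  have v: "v \<in> carrier_vec (n * n)" by (simp add: v_def)
  have sw_cong: "sandwich n f X g = sandwich n f' X g'" if "\<And>b. b < n \<Longrightarrow> f b = f' b" "\<And>b. b < n \<Longrightarrow> g b = g' b" for f f' g g'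
    using that by (simp add: sandwich_def fun_eq_iff)
  have 1: "re_pairing c n (sandwich n c2 X (\<lambda>b l. e b l - c1 b l)) = 0"
    using u1(3) by (intro null1) (simp add: c1_def)
  have 2: "re_pairing c n (sandwich n (\<lambda>b l. e b l - c2 b l) X e) = 0"
    using u2(3) by (intro null2) (simp add: c2_def)
  \<comment> \<open>The null rows are dropped one side at a time: \<open>null1\<close> allows any
    left matrix, \<open>null2\<close> any right matrix.\<close>
  from 1 have "re_pairing c n (sandwich n c2 X c1) = re_pairing c n (sandwich n c2 X e)"
    unfolding sandwich_diff_right re_pairing_add re_pairing_scale by simp
  also from 2 have "re_pairing c n (sandwich n c2 X e) = re_pairing c n (sandwich n e X e)"
    unfolding sandwich_diff_left re_pairing_add re_pairing_scale by simp
  also have "\<dots> = re_pairing c n (entries X)"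
    by (rule re_pairing_cong) (simp add: e_def entries_def sandwich_identity)
  finally have "1 \<le> re_pairing c n (sandwich n c2 X c1)" using ge by simp
  also have "sandwich n c2 X c1 = sandwich n (\<lambda>b k. \<Sum>a<n. w (a * n + b) * u2 a k) X (\<lambda>b l. \<Sum>a<n. v $ (a * n + b) * u1 a l)"
    by (rule sw_cong) (auto simp: c1_def c2_def w_def v_def mult_add_less fun_eq_iff)
  also have "re_pairing c n \<dots> = Re (\<Sum>i<n * n. cnj (w i) * (pencil n n Q X *\<^sub>v v) $ i)"
    unfolding Q_def by (rule pencil_coefficient_form[OF Xm v, symmetric])
  also have "\<dots> \<le> sqrt (sq_norm (n * n) w) * vec_norm (pencil n n Q X *\<^sub>v v)"
    using Re_sum_cnj_le[of w "\<lambda>i. (pencil n n Q X *\<^sub>v v) $ i" "n * n"] by (simp add: vec_norm_eq pencil_def)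
  also have "\<dots> \<le> sqrt (sq_norm (n * n) w) * (op_norm (pencil n n Q X) * vec_norm v)"
    using v by (intro mult_left_mono vec_norm_mult_le) (auto simp: pencil_def sq_norm_nonneg)
  also have "\<dots> = op_norm (pencil n n Q X) * (sqrt (sq_norm (n * n) w) * sqrt (sq_norm (n * n) (\<lambda>i. v $ i)))"
    using v by (simp add: vec_norm_eq)
  also have "\<dots> \<le> op_norm (pencil n n Q X) * 1"
  proof (rule mult_left_mono[OF _ op_norm_nonneg])
    have W: "sq_norm (n * n) w \<le> (\<Sum>k<n. Re (T2 k k))"
      unfolding blocks[symmetric] using u2(2) by (intro sum_mono) (simp add: w_def sesq_e[symmetric])
    have V: "sq_norm (n * n) (\<lambda>i. v $ i) \<le> (\<Sum>k<n. Re (T1 k k))"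
      unfolding blocks[symmetric] using u1(2)
      by (intro sum_mono) (simp add: v_def sesq_e[symmetric] mult_add_less)
    \<comment> \<open>By the arithmetic-geometric mean inequality the product is at most half the
      sum of the two traces, hence at most 1.\<close>
    show "sqrt (sq_norm (n * n) w) * sqrt (sq_norm (n * n) (\<lambda>i. v $ i)) \<le> 1"
      using arith_geo_mean_sqrt[OF sq_norm_nonneg[of "n * n" w] sq_norm_nonneg[of "n * n" "\<lambda>i. v $ i"]] V W trace
      by (simp add: real_sqrt_mult)
  qed
  finally have "op_norm (pencil n n Q X) \<ge> 1" by simp
  with Q upper show thesis by (rule that)
qed

end

theorem propositionA4:
  fixes \<C> :: "nat \<Rightarrow> ('g::finite \<Rightarrow> complex mat) set"
    and X\<^sub>b :: "'g \<Rightarrow> complex mat"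
    and n :: nat and \<epsilon> :: real
  assumes "\<And>k. k \<ge> 1 \<Longrightarrow> \<C> k \<subseteq> mat_tuples k"
    and "matrix_balanced \<C>"
    and "closed_direct_sums \<C>"
    and "\<epsilon> > 0" and "\<And>k. k \<ge> 1 \<Longrightarrow> free_nbhd \<epsilon> k \<subseteq> \<C> k"
    and "n \<ge> 1" and "X\<^sub>b \<in> tuple_topology n frontier_of \<C> n"
  shows "\<exists>Q \<in> mat_tuples n.
      (\<forall>m\<ge>1. \<forall>Y \<in> \<C> m. op_norm (pencil n m Q Y) \<le> 1) \<and>
      op_norm (pencil n n Q X\<^sub>b) = 1 \<and>
      (\<forall>m\<ge>1. \<forall>Y \<in> tuple_topology m interior_of \<C> m. op_norm (pencil n m Q Y) < 1)"
proof -
  interpret balanced_family \<C> \<epsilon> using assms by unfold_locales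
  have n: "n \<ge> 1" by fact
  obtain Q where Q: "Q \<in> mat_tuples n"
    and le: "\<And>m Y. m \<ge> 1 \<Longrightarrow> Y \<in> \<C> m \<Longrightarrow> op_norm (pencil n m Q Y) \<le> 1"
    and ge: "op_norm (pencil n n Q X\<^sub>b) \<ge> 1"
    using norming_pencil[OF n assms(7)] by metis
  have scaled: "t * op_norm (pencil n m Q Y) \<le> 1"
    if "m \<ge> 1" "Y \<in> mat_tuples m" "t > 0" "(\<lambda>j. of_real t \<cdot>\<^sub>m Y j) \<in> \<C> m" for m Y t
    using le[OF that(1) that(4)] that(3) by (simp add: pencil_smult[OF Q that(2)] op_norm_smult)
  have cl: "X\<^sub>b \<in> tuple_topology n closure_of \<C> n" using assms(7) by (simp add: frontier_of_def)
  have "op_norm (pencil n n Q X\<^sub>b) \<le> 1"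
  \<comment> \<open>The boundary point is reached through its dilations with t < 1, which belong to
    the family.\<close>
  proof (rule field_le_mult_one_interval)
    fix t :: real assume t: "0 < t" "t < 1"
    show "t * op_norm (pencil n n Q X\<^sub>b) \<le> 1"
      by (rule scaled[OF n closure_shrink(1)[OF n cl t] t(1) closure_shrink(2)[OF n cl t]])
  qed
  moreover have "op_norm (pencil n m Q Y) < 1"
    if m: "m \<ge> 1" and Y: "Y \<in> tuple_topology m interior_of \<C> m" for m Y
  proof -
    obtain s where s: "s > 1" "(\<lambda>j. of_real s \<cdot>\<^sub>m Y j) \<in> \<C> m" "Y \<in> \<C> m" using interior_expand[OF m Y] .
    then have *: "s * op_norm (pencil n m Q Y) \<le> 1" using scaled[OF m, of Y s] subset[OF m] by auto
    show ?thesis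
    proof (rule ccontr)
      assume "\<not> ?thesis"
      \<comment> \<open>A norm of at least 1 at Y would give norm at least s > 1 at s Y, which still
        belongs to the family.\<close>
      then have "s * 1 \<le> s * op_norm (pencil n m Q Y)" using s by (intro mult_left_mono) auto
      then show False using s(1) * by linarith
    qed
  qed
  ultimately show ?thesis using Q le ge by (intro bexI[of _ Q] conjI) auto
qed

end
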